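(* Let $\mu,\nu\in\mathcal{P}_2(\mathbb{R}^d)$ have the same barycentre, $[\mu]=[\nu]$, and put $f=\nu-\mu$. Let $$\mathcal{I}(f)=\sup\Big\{\int u\,d\nu-\int u\,d\mu \;:\; u\in C^{1,1}(\mathbb{R}^d),\ \mathrm{lip}(\nabla u)\le 1\Big\},$$ $$\mathcal{J}(\mu,\nu)=\inf\Big\{\iiint c(x,y,z)\,\pi(dxdydz)\;:\;\pi\in\Sigma(\mu,\nu)\Big\},\qquad c(x,y,z)=\tfrac12\big(|z-x|^2+|z-y|^2\big).$$ Then: (i) $\mathcal{I}(f)=\mathcal{J}(\mu,\nu)$, and there exist $u$ attaining the supremum in $\mathcal{I}(f)$ and $\pi$ attaining the infimum in $\mathcal{J}(\mu,\nu)$; (ii) an admissible pair $(u,\pi)$ (i.e. $u\in C^{1,1}(\mathbb{R}^d)$ with $\mathrm{lip}(\nabla u)\le1$ and $\pi\in\Sigma(\mu,\nu)$) is optimal for both problems if and only if $$[u(y)+\langle\nabla u(y),z-y\rangle]-[u(x)+\langle\nabla u(x),z-x\rangle]=c(x,y,z)\quad\text{for }\pi\text{-a.e. }(x,y,z).$$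
   Context: $\mathcal{P}_2(\mathbb{R}^k)$ denotes Borel probability measures on $\mathbb{R}^k$ with finite second moment; $[\mu]=\int x\,\mu(dx)$ is the barycentre. $\mathrm{lip}(v)$ is the Lipschitz constant of $v$. $\Sigma(\mu,\nu)$ is the set of $\pi\in\mathcal{P}_2((\mathbb{R}^d)^3)$ whose first marginal is $\mu$, whose second marginal is $\nu$, and such that $\iiint\langle z-x,\Phi(x)\rangle\,\pi(dxdydz)=\iiint\langle z-y,\Psi(y)\rangle\,\pi(dxdydz)=0$ for all smooth compactly supported test maps $\Phi,\Psi:\mathbb{R}^d\to\mathbb{R}^d$. *)

theory Defs
  imports "HOL-Probability.Probability"
begin

definition P2 :: "'a::euclidean_space measure \<Rightarrow> bool" where
  "P2 M \<longleftrightarrow> prob_space M \<and> sets M = sets borel \<and> integrable M (\<lambda>x. (norm x)^2)"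

definition bary :: "'a::euclidean_space measure \<Rightarrow> 'a" where
  "bary M = (\<integral>x. x \<partial>M)"

text \<open>Smooth (C-infinity) maps: all iterated partial derivatives exist everywhere and are continuous.\<close>
definition smooth :: "('a::euclidean_space \<Rightarrow> 'b::real_normed_vector) \<Rightarrow> bool" where
  "smooth f \<longleftrightarrow> (\<exists>F. f \<in> F \<and> (\<forall>g\<in>F. continuous_on UNIV g) \<and>
     (\<forall>g\<in>F. \<forall>b\<in>Basis. \<exists>g'\<in>F. \<forall>x. ((\<lambda>t. g (x + t *\<^sub>R b)) has_vector_derivative g' x) (at 0)))"

definition compact_support :: "('a::euclidean_space \<Rightarrow> 'b::real_normed_vector) \<Rightarrow> bool" where
  "compact_support f \<longleftrightarrow> compact (closure {x. f x \<noteq> 0})"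

definition grad :: "('a::euclidean_space \<Rightarrow> real) \<Rightarrow> 'a \<Rightarrow> 'a" where
  "grad u x = (THE g. (u has_derivative (\<lambda>h. g \<bullet> h)) (at x))"

definition adm :: "('a::euclidean_space \<Rightarrow> real) \<Rightarrow> bool" where
  "adm u \<longleftrightarrow> (\<exists>Du. (\<forall>x. (u has_derivative (\<lambda>h. Du x \<bullet> h)) (at x)) \<and>
                    (\<forall>x y. norm (Du x - Du y) \<le> norm (x - y)))"

definition Sigma_mart :: "'a::euclidean_space measure \<Rightarrow> 'a measure \<Rightarrow> ('a \<times> 'a \<times> 'a) measure set" where
  "Sigma_mart \<mu> \<nu> = {\<pi>. P2 \<pi> \<and> distr \<pi> borel fst = \<mu> \<and> distr \<pi> borel (\<lambda>(x,y,z). y) = \<nu> \<and>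
     (\<forall>\<Phi>::'a \<Rightarrow> 'a. smooth \<Phi> \<and> compact_support \<Phi> \<longrightarrow> (\<integral>(x,y,z). (z - x) \<bullet> \<Phi> x \<partial>\<pi>) = 0) \<and>
     (\<forall>\<Psi>::'a \<Rightarrow> 'a. smooth \<Psi> \<and> compact_support \<Psi> \<longrightarrow> (\<integral>(x,y,z). (z - y) \<bullet> \<Psi> y \<partial>\<pi>) = 0)}"

definition cost :: "'a::euclidean_space \<Rightarrow> 'a \<Rightarrow> 'a \<Rightarrow> real" where
  "cost x y z = ((norm (z - x))^2 + (norm (z - y))^2) / 2"

definition gain :: "'a::euclidean_space measure \<Rightarrow> 'a measure \<Rightarrow> ('a \<Rightarrow> real) \<Rightarrow> real" where
  "gain \<mu> \<nu> u = (\<integral>x. u x \<partial>\<nu>) - (\<integral>x. u x \<partial>\<mu>)"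

definition total_cost :: "('a::euclidean_space \<times> 'a \<times> 'a) measure \<Rightarrow> real" where
  "total_cost \<pi> = (\<integral>(x,y,z). cost x y z \<partial>\<pi>)"

definition Ival :: "'a::euclidean_space measure \<Rightarrow> 'a measure \<Rightarrow> ereal" where
  "Ival \<mu> \<nu> = (SUP u\<in>{u. adm u}. ereal (gain \<mu> \<nu> u))"

definition Jval :: "'a::euclidean_space measure \<Rightarrow> 'a measure \<Rightarrow> ereal" where
  "Jval \<mu> \<nu> = (INF \<pi>\<in>Sigma_mart \<mu> \<nu>. ereal (total_cost \<pi>))"

end

theory Submission
  imports Defs "HOL-Complex_Analysis.Great_Picard"
begin

text \<open>A maximising sequence for \<open>I\<close>, normalised to vanish to first order at the origin, is precompact
  by Arzela--Ascoli, which gives an optimal \<open>u\<close>. For the primal problem, relax the dual to independent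
  \<open>u, v, p, q\<close> with \<open>v(y) + q(y)\<cdot>(z - y) - u(x) - p(x)\<cdot>(z - x) \<le> c(x, y, z)\<close>. The relaxation has the same
  value, since any such quadruple is separated by an admissible function: \<open>v \<le> U \<le> u\<close>. A
  Hahn--Banach argument then yields a positive functional on all functions of quadratic growth on the
  space of triples which has marginals \<open>\<mu>\<close> and \<open>\<nu>\<close>, annihilates the martingale test functions and takes a
  value at most \<open>I\<close> at \<open>c\<close>. It is represented on bounded continuous functions by a measure, which is the
  desired coupling: the test functions grow subquadratically, so they see no mass escaping to infinity,
  and for \<open>c\<close> an escape can only decrease the cost.\<close>

section \<open>Functions with 1-Lipschitz gradient\<close>

text \<open>In the linear programme dual to \<open>Jval\<close>, \<open>u\<close> and
  \<open>v\<close> are multipliers of the two marginal constraints and \<open>p\<close>,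
  \<open>q\<close> those of the two martingale constraints, so nothing ties \<open>p\<close> to a
  gradient or \<open>u\<close> to \<open>v\<close>; interpolation brings this larger problem back to
  a single admissible function. It is possible because \<open>cost\<close> is the sum of the two
  parabola errors that a function with 1-Lipschitz gradient may have at \<open>z\<close>, seen from
  \<open>x\<close> and from \<open>y\<close>. The slack, \<open>cost\<close> minus contact gap, is
  therefore nonnegative, and its integral against a coupling is \<open>total_cost\<close> minus
  \<open>gain\<close>: weak duality and criterion (ii) both come from this one quantity. Two gaps
  have to be bridged. The constraints of \<open>Sigma_mart\<close> test only with smooth compactly
  supported maps, whereas gradients are merely Lipschitz and may grow linearly; hence the bump
  functions. And the functional is a priori only finitely additive, on a noncompact space; carried
  to the real line it can be discretised, and tightness of the resulting distributions yields a
  countably additive measure.\<close>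

text \<open>The inequality \<open>key\<close> for \<open>u\<close> and the one for \<open>-u\<close>
  have opposite values and linear terms. Their sum leaves only |Du y - Du x|^2 / 2 \<le> |y - x|^2 /
  2.\<close>

lemma quadratic_bound_imp_nonexpansive:
  fixes u :: "'a::real_inner \<Rightarrow> real"
  assumes "\<And>x y. \<bar>u y - u x - Du x \<bullet> (y - x)\<bar> \<le> (norm (y - x))\<^sup>2 / 2"
  shows "norm (Du x - Du y) \<le> norm (x - y)"
proof -
  have key: "v y - v x - (p x + p y) \<bullet> (y - x) / 2 + (norm (p y - p x))\<^sup>2 / 4 \<le> (norm (y - x))\<^sup>2 / 4"
    if "\<And>x y. \<bar>v y - v x - p x \<bullet> (y - x)\<bar> \<le> (norm (y - x))\<^sup>2 / 2" for v :: "'a \<Rightarrow> real" and p x y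
  proof -
    \<comment> \<open>The maximiser of the gap between the lower parabola at \<open>y\<close> and the upper one at \<open>x\<close>.\<close>
    define z where "z = (1/2) *\<^sub>R (x + y) + (1/2) *\<^sub>R (p y - p x)"
    have 1: "v z \<le> v x + p x \<bullet> (z - x) + (norm (z - x))\<^sup>2 / 2"
      using that[of z x] by linarith
    have 2: "v z \<ge> v y + p y \<bullet> (z - y) - (norm (z - y))\<^sup>2 / 2"
      using that[of z y] by linarith
    have "v y + p y \<bullet> (z - y) - (v x + p x \<bullet> (z - x)) \<le> ((norm (z - x))\<^sup>2 + (norm (z - y))\<^sup>2) / 2"
      using 1 2 by (simp add: field_simps)
    then show ?thesis
      unfolding z_def power2_norm_eq_inner
      by (simp add: inner_simps inner_commute field_simps)
  qed
  have 1: "u y - u x - (Du x + Du y) \<bullet> (y - x) / 2 + (norm (Du y - Du x))\<^sup>2 / 4 \<le> (norm (y - x))\<^sup>2 / 4"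
    using assms by (rule key)
  have "- u y - - u x - (- Du x + - Du y) \<bullet> (y - x) / 2 + (norm (- Du y - - Du x))\<^sup>2 / 4 \<le> (norm (y - x))\<^sup>2 / 4"
  proof (rule key)
    show "\<bar>- u y - - u x - (- Du x) \<bullet> (y - x)\<bar> \<le> (norm (y - x))\<^sup>2 / 2" for x y
      using assms[of y x] unfolding inner_minus_left by arith
  qed
  moreover have "(- Du x + - Du y) \<bullet> (y - x) = - ((Du x + Du y) \<bullet> (y - x))"
    by (simp only: inner_minus_left inner_add_left)
  moreover have "norm (- Du y - - Du x) = norm (Du y - Du x)"
    by (simp add: norm_minus_commute)
  ultimately have "(norm (Du y - Du x))\<^sup>2 \<le> (norm (y - x))\<^sup>2"
    using 1 by (simp only:)
  then show ?thesis
    by (simp add: norm_minus_commute)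
qed

text \<open>Along the segment from \<open>x\<close> to \<open>y\<close>, subtracting the upper
  parabola leaves a function \<open>g\<close> of \<open>t\<close> with nonpositive derivative, by
  Cauchy-Schwarz and the Lipschitz bound. The lower estimate is the upper one for
  \<open>-u\<close>.\<close>

lemma C11_quadratic_bound:
  fixes u :: "'a::euclidean_space \<Rightarrow> real"
  assumes deriv: "\<And>x. (u has_derivative (\<lambda>h. Du x \<bullet> h)) (at x)"
    and lip: "\<And>x y. norm (Du x - Du y) \<le> norm (x - y)"
  shows "\<bar>u y - u x - Du x \<bullet> (y - x)\<bar> \<le> (norm (y - x))\<^sup>2 / 2"
proof -
  have upper: "v y - v x - p x \<bullet> (y - x) \<le> (norm (y - x))\<^sup>2 / 2"
    if v: "\<And>x. (v has_derivative (\<lambda>h. p x \<bullet> h)) (at x)"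
      and p: "\<And>x y. norm (p x - p y) \<le> norm (x - y)" for v :: "'a \<Rightarrow> real" and p
  proof -
    define h where "h = y - x"
    define g where "g t = v (x + t *\<^sub>R h) - t * (p x \<bullet> h) - t\<^sup>2 * (norm h)\<^sup>2 / 2" for t
    have "(g has_real_derivative (p (x + t *\<^sub>R h) \<bullet> h - p x \<bullet> h - t * (norm h)\<^sup>2)) (at t)" for t
    proof -
      have "((\<lambda>t. v (x + t *\<^sub>R h)) has_derivative (\<lambda>s. p (x + t *\<^sub>R h) \<bullet> (s *\<^sub>R h))) (at t)"
        by (rule has_derivative_compose[OF _ v]) (auto intro!: derivative_eq_intros)
      then have *: "((\<lambda>t. v (x + t *\<^sub>R h)) has_real_derivative (p (x + t *\<^sub>R h) \<bullet> h)) (at t)"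
        unfolding has_field_derivative_def by (simp add: mult.commute[of _ "_ \<bullet> _"])
      show ?thesis
        unfolding g_def by (rule derivative_eq_intros * refl | simp)+
    qed
    moreover have "p (x + t *\<^sub>R h) \<bullet> h - p x \<bullet> h - t * (norm h)\<^sup>2 \<le> 0" if "t \<ge> 0" for t
    proof -
      have "(p (x + t *\<^sub>R h) - p x) \<bullet> h \<le> norm (p (x + t *\<^sub>R h) - p x) * norm h"
        by (rule norm_cauchy_schwarz)
      also have "\<dots> \<le> norm (t *\<^sub>R h) * norm h"
        using p[of "x + t *\<^sub>R h" x] by (intro mult_right_mono) auto
      finally show ?thesis using that by (simp add: inner_diff_left power2_eq_square)
    qed
    ultimately have "g 1 \<le> g 0"
      by (intro DERIV_nonpos_imp_nonincreasing[of 0 1 g]) force+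
    then show ?thesis by (simp add: g_def h_def)
  qed
  have "((\<lambda>x. - u x) has_derivative (\<lambda>h. (- Du x) \<bullet> h)) (at x)" for x
    using has_derivative_minus[OF deriv] by simp
  moreover have "norm (- Du x - - Du y) \<le> norm (x - y)" for x y
    using lip[of x y] by (metis minus_diff_minus norm_minus_cancel)
  ultimately have "- u y - - u x - (- Du x) \<bullet> (y - x) \<le> (norm (y - x))\<^sup>2 / 2"
    by (rule upper)
  with upper[OF deriv lip] show ?thesis
    unfolding inner_minus_left abs_le_iff by linarith
qed

lemma quadratic_bound_imp_has_derivative:
  fixes u :: "'a::euclidean_space \<Rightarrow> real"
  assumes "\<And>y. \<bar>u y - u x - d \<bullet> (y - x)\<bar> \<le> (norm (y - x))\<^sup>2 / 2"
  shows "(u has_derivative (\<lambda>h. d \<bullet> h)) (at x)"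
  unfolding has_derivative_at
proof
  show "bounded_linear ((\<bullet>) d)"
    by (rule bounded_linear_inner_right)
  show "(\<lambda>h. norm (u (x + h) - u x - d \<bullet> h) / norm h) \<midarrow>0\<rightarrow> 0"
  proof (rule tendsto_sandwich[OF _ _ tendsto_const])
    show "\<forall>\<^sub>F h in at 0. norm (u (x + h) - u x - d \<bullet> h) / norm h \<le> norm h / 2"
    proof (rule eventually_at_filter[THEN iffD2], rule always_eventually, safe)
      fix h :: 'a assume "h \<noteq> 0"
      then show "norm (u (x + h) - u x - d \<bullet> h) / norm h \<le> norm h / 2"
        using assms[of "x + h"] by (simp add: field_simps power2_eq_square)
    qed
    show "((\<lambda>h::'a. norm h / 2) \<longlongrightarrow> 0) (at 0)"
      by (auto intro!: tendsto_eq_intros)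
  qed auto
qed

text \<open>This form mentions no derivative, so it passes to pointwise limits and can be checked
  directly for a function built as a supremum.\<close>

lemma adm_iff_quadratic_bound:
  fixes u :: "'a::euclidean_space \<Rightarrow> real"
  shows "adm u \<longleftrightarrow> (\<exists>Du. \<forall>x y. \<bar>u y - u x - Du x \<bullet> (y - x)\<bar> \<le> (norm (y - x))\<^sup>2 / 2)"
proof
  assume "adm u"
  then show "\<exists>Du. \<forall>x y. \<bar>u y - u x - Du x \<bullet> (y - x)\<bar> \<le> (norm (y - x))\<^sup>2 / 2"
    unfolding adm_def by (meson C11_quadratic_bound)
next
  assume "\<exists>Du. \<forall>x y. \<bar>u y - u x - Du x \<bullet> (y - x)\<bar> \<le> (norm (y - x))\<^sup>2 / 2"
  then obtain Du where "\<And>x y. \<bar>u y - u x - Du x \<bullet> (y - x)\<bar> \<le> (norm (y - x))\<^sup>2 / 2"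
    by blast
  then show "adm u"
    unfolding adm_def
    by (intro exI[of _ Du] conjI allI quadratic_bound_imp_has_derivative quadratic_bound_imp_nonexpansive)
qed

lemma grad_eqI:
  fixes u :: "'a::euclidean_space \<Rightarrow> real"
  assumes "(u has_derivative (\<lambda>h. d \<bullet> h)) (at x)"
  shows "grad u x = d"
  unfolding grad_def
proof (rule the_equality)
  show "(u has_derivative (\<bullet>) d) (at x)"
    by (rule assms)
next
  fix g assume "(u has_derivative (\<bullet>) g) (at x)"
  then have "(\<bullet>) g = (\<bullet>) d"
    using assms by (rule has_derivative_unique)
  then show "g = d"
    by (metis vector_eq_rdot)
qed

lemma adm_grad:
  fixes u :: "'a::euclidean_space \<Rightarrow> real"
  assumes "adm u"
  shows "\<bar>u y - u x - grad u x \<bullet> (y - x)\<bar> \<le> (norm (y - x))\<^sup>2 / 2"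
    and "norm (grad u x - grad u y) \<le> norm (x - y)"
proof -
  obtain Du where Du: "\<And>x. (u has_derivative (\<lambda>h. Du x \<bullet> h)) (at x)"
      "\<And>x y. norm (Du x - Du y) \<le> norm (x - y)"
    using assms unfolding adm_def by blast
  have "grad u = Du"
    using grad_eqI[OF Du(1)] by auto
  then show "\<bar>u y - u x - grad u x \<bullet> (y - x)\<bar> \<le> (norm (y - x))\<^sup>2 / 2"
    "norm (grad u x - grad u y) \<le> norm (x - y)"
    using C11_quadratic_bound[OF Du] Du(2) by auto
qed

section \<open>Interpolation between upper and lower parabolas\<close>

text \<open>Absorbs the linear term by (a - 4b)^2 \<ge> 0. It bounds the slopes of those affine
  functions in \<open>D\<close> that are not too small at a given point.\<close>

lemma norm_sq_le_of_quadratic: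
  fixes a b c :: real
  assumes "a\<^sup>2 / 4 \<le> c + a * b"
  shows "a\<^sup>2 \<le> 8 * c + 16 * b\<^sup>2"
proof -
  have "0 \<le> (a - 4 * b)\<^sup>2"
    by simp
  then show ?thesis
    using assms by (simp add: power2_eq_square algebra_simps)
qed

text \<open>With \<open>F(z)\<close> the infimum over \<open>x\<close> of \<open>u(x) + p(x)\<cdot>(z - x) + |z - x|\<^sup>2/2 + |z|\<^sup>2/2\<close>, the interpolant is
  \<open>F\<^sup>*\<^sup>* - |z|\<^sup>2/2\<close>. The set \<open>D\<close> below is the epigraph of \<open>F\<^sup>*\<close>: minimising over \<open>z\<close>, the affine function
  \<open>\<xi>\<cdot>z - s\<close> lies below \<open>F\<close> iff \<open>|\<xi> + x - p(x)|\<^sup>2/4 \<le> u(x) - p(x)\<cdot>x + |x|\<^sup>2/2 + s\<close> for all \<open>x\<close>. This makes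
  \<open>F\<^sup>*\<close> strongly convex, whence the \<open>C\<^sup>1\<^sup>,\<^sup>1\<close> bound on the biconjugate.\<close>

theorem three_point_interpolation:
  fixes u v :: "'a::euclidean_space \<Rightarrow> real" and p q :: "'a \<Rightarrow> 'a"
  assumes le: "\<And>x y z. v y + q y \<bullet> (z - y) - (u x + p x \<bullet> (z - x)) \<le> cost x y z"
  obtains U where "adm U" "\<And>x. v x \<le> U x" "\<And>x. U x \<le> u x"
proof -
  define k where "k x = u x - p x \<bullet> x + (norm x)\<^sup>2 / 2" for x
  define D where "D = {d. \<forall>x. (norm (fst d + x - p x))\<^sup>2 / 4 \<le> k x + snd d}"
  define e where "e d z = fst d \<bullet> z - snd d" for d :: "'a \<times> real" and z
  \<comment> \<open>Adding |z|^2/2 to the lower parabola v(y) + q(y).(z - y) - |z - y|^2/2 cancels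
    the quadratic term and leaves exactly this affine function. Its value at \<open>y\<close> is
    v(y) + |y|^2/2, which later gives \<open>v\<close> \<le> \<open>U\<close>.\<close>
  have lower: "(q y + y, q y \<bullet> y + (norm y)\<^sup>2 / 2 - v y) \<in> D" for y
    unfolding D_def mem_Collect_eq fst_conv snd_conv
  proof
    fix x
    show "(norm (q y + y + x - p x))\<^sup>2 / 4 \<le> k x + (q y \<bullet> y + (norm y)\<^sup>2 / 2 - v y)"
      \<comment> \<open>This \<open>z\<close> minimises the difference of the two sides, a quadratic
        |z|^2 - w.z up to constants with w = q y + y + x - p x; the minimum contributes
        -|w|^2/4.\<close>
      using le[where x=x and y=y and z="(1/2) *\<^sub>R (q y + y + x - p x)"]
      unfolding cost_def k_def power2_norm_eq_inner
      by (simp add: inner_simps inner_commute field_simps)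
  qed
  have upper: "e d x \<le> u x + (norm x)\<^sup>2 / 2" if "d \<in> D" for d x
  proof -
    define w where "w = fst d + x - p x"
    have "0 \<le> (norm (x - (1/2) *\<^sub>R w))\<^sup>2"
      by simp
    moreover have "(norm w)\<^sup>2 / 4 \<le> k x + snd d"
      using that by (auto simp: D_def w_def)
    ultimately show ?thesis
      unfolding e_def k_def w_def power2_norm_eq_inner
      by (simp add: inner_simps inner_commute field_simps)
  qed
  have "closed D"
    unfolding D_def by (intro closed_Collect_all closed_Collect_le continuous_intros) auto
  \<comment> \<open>The supremum defining the biconjugate at \<open>z\<close> is attained: members
    of \<open>D\<close> at least as good at \<open>z\<close> as the reference \<open>d0\<close> form
    a compact set. The constraint of \<open>D\<close> at \<open>x = 0\<close> bounds the height from
    below by the slope, and comparison with \<open>d0\<close> bounds it from above. The maximiser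
    \<open>m z\<close> then supplies a supporting slope, hence the gradient of
    \<open>U\<close>.\<close>
  have "\<exists>m\<in>D. \<forall>d\<in>D. e d z \<le> e m z" for z
  proof -
    define d0 where "d0 = (q 0 + 0, q 0 \<bullet> 0 + (norm (0::'a))\<^sup>2 / 2 - v 0)"
    define K where "K = {d \<in> D. e d0 z \<le> e d z}"
    define B where "B = 8 * (k 0 - e d0 z + p 0 \<bullet> z) + 16 * (norm z)\<^sup>2"
    have "d0 \<in> K"
      using lower[of 0] by (simp add: K_def d0_def)
    have "closed K"
      unfolding K_def using \<open>closed D\<close>
      by (auto simp: e_def Collect_conj_eq intro!: closed_Int closed_Collect_le continuous_intros)
    have 1: "(norm (fst d - p 0))\<^sup>2 \<le> B" if "d \<in> K" for d
      unfolding B_def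
    proof (rule norm_sq_le_of_quadratic)
      have "(norm (fst d - p 0))\<^sup>2 / 4 \<le> k 0 + snd d"
        using that by (simp add: K_def D_def) (metis add.right_neutral)
      moreover have "snd d \<le> fst d \<bullet> z - e d0 z"
        using that by (simp add: K_def e_def)
      moreover have "(fst d - p 0) \<bullet> z \<le> norm (fst d - p 0) * norm z"
        by (rule norm_cauchy_schwarz)
      ultimately show "(norm (fst d - p 0))\<^sup>2 / 4 \<le> k 0 - e d0 z + p 0 \<bullet> z + norm (fst d - p 0) * norm z"
        by (simp add: inner_diff_left)
    qed
    have 2: "norm (fst d) \<le> norm (p 0) + sqrt B" if "d \<in> K" for d
      using real_le_rsqrt[OF 1[OF that]] norm_triangle_sub[of "fst d" "p 0"] by linarith
    have 3: "\<bar>snd d\<bar> \<le> \<bar>k 0\<bar> + (norm (p 0) + sqrt B) * norm z + \<bar>e d0 z\<bar>" if "d \<in> K" for d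
    proof -
      have "0 \<le> (norm (fst d - p 0))\<^sup>2 / 4"
        by simp
      also have "\<dots> \<le> k 0 + snd d"
        using that by (simp add: K_def D_def) (metis add.right_neutral)
      finally have "- k 0 \<le> snd d" by simp
      moreover have "snd d \<le> fst d \<bullet> z - e d0 z"
        using that by (simp add: K_def e_def)
      moreover have "fst d \<bullet> z \<le> (norm (p 0) + sqrt B) * norm z"
        using norm_cauchy_schwarz[of "fst d" z] mult_right_mono[OF 2[OF that], of "norm z"] by auto
      moreover have "0 \<le> (norm (p 0) + sqrt B) * norm z"
        using 2[OF that] by (meson dual_order.trans mult_nonneg_nonneg norm_ge_zero)
      ultimately show ?thesis by linarith
    qed
    have "bounded K"
      unfolding bounded_iff
    proof (intro exI ballI)
      fix d assume "d \<in> K"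
      have "norm d \<le> norm (fst d) + norm (snd d)"
        by (metis norm_Pair_le prod.collapse)
      then show "norm d \<le> (norm (p 0) + sqrt B) + (\<bar>k 0\<bar> + (norm (p 0) + sqrt B) * norm z + \<bar>e d0 z\<bar>)"
        using 2[OF \<open>d \<in> K\<close>] 3[OF \<open>d \<in> K\<close>] by simp
    qed
    then have "compact K"
      using \<open>closed K\<close> by (simp add: compact_eq_bounded_closed)
    then obtain m where "m \<in> K" "\<forall>d\<in>K. e d z \<le> e m z"
      using continuous_attains_sup[of K "\<lambda>d. e d z"] \<open>d0 \<in> K\<close>
      by (fastforce simp: e_def intro!: continuous_intros)
    then show ?thesis
      using \<open>d0 \<in> K\<close> by (intro bexI[of _ m]) (force simp: K_def)+
  qed
  then obtain m where m: "\<And>z. m z \<in> D" and max: "\<And>z d. d \<in> D \<Longrightarrow> e d z \<le> e (m z) z"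
    by metis
  \<comment> \<open>A convex combination of two members of \<open>D\<close> may be lowered in height
    by t (1 - t) \<open>c\<close> and still satisfies every constraint, since the squared norm is
    strongly convex. Comparing \<open>m z\<close> with this competitor, dividing by \<open>t\<close>
    and letting \<open>t\<close> tend to 0 gives the quadratic deficit.\<close>
  have strict: "e d z \<le> e (m z) z - (norm (fst (m z) - fst d))\<^sup>2 / 4" if "d \<in> D" for d z
  proof -
    define c where "c = (norm (fst (m z) - fst d))\<^sup>2 / 4"
    have "e d z + (1 - t) * c \<le> e (m z) z" if t: "0 < t" "t < 1" for t
    proof -
      define b where "b = ((1 - t) *\<^sub>R fst (m z) + t *\<^sub>R fst d, (1 - t) * snd (m z) + t * snd d - t * (1 - t) * c)"
      have "b \<in> D"
        unfolding D_def
      proof safe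
        fix x
        define A where "A = fst (m z) + x - p x"
        define C where "C = fst d + x - p x"
        have "(norm (fst b + x - p x))\<^sup>2 = (norm ((1 - t) *\<^sub>R A + t *\<^sub>R C))\<^sup>2"
          by (simp add: b_def A_def C_def algebra_simps)
        also have "\<dots> = (1 - t) * (norm A)\<^sup>2 + t * (norm C)\<^sup>2 - t * (1 - t) * (norm (A - C))\<^sup>2"
          unfolding power2_norm_eq_inner by (simp add: inner_simps inner_commute algebra_simps)
        also have "A - C = fst (m z) - fst d"
          by (simp add: A_def C_def)
        finally have "(norm (fst b + x - p x))\<^sup>2 / 4
            = (1 - t) * ((norm A)\<^sup>2 / 4) + t * ((norm C)\<^sup>2 / 4) - t * (1 - t) * c"
          by (simp add: c_def field_simps)
        also have "\<dots> \<le> (1 - t) * (k x + snd (m z)) + t * (k x + snd d) - t * (1 - t) * c"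
          using m[of z] \<open>d \<in> D\<close> t
          by (intro diff_right_mono add_mono mult_left_mono) (auto simp: D_def A_def C_def)
        also have "\<dots> = k x + snd b"
          by (simp add: b_def algebra_simps)
        finally show "(norm (fst b + x - p x))\<^sup>2 / 4 \<le> k x + snd b" .
      qed
      from max[OF this, of z]
      have "t * (e d z + (1 - t) * c) \<le> t * e (m z) z"
        by (simp add: e_def b_def inner_simps algebra_simps)
      then show ?thesis using t by simp
    qed
    moreover have "((\<lambda>t. e d z + (1 - t) * c) \<longlongrightarrow> e d z + (1 - 0) * c) (at_right 0)"
      by (intro tendsto_intros)
    ultimately have "e d z + (1 - 0) * c \<le> e (m z) z"
      by (intro tendsto_upperbound) (auto simp: eventually_at_right_field intro!: exI[of _ 1])
    then show ?thesis by (simp add: c_def)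
  qed
  define U where "U z = e (m z) z - (norm z)\<^sup>2 / 2" for z
  \<comment> \<open>The supremum of affine functions lies between its tangent at \<open>x\<close>
    and that tangent plus |y - x|^2: below by maximality of \<open>m y\<close>, above by
    \<open>strict\<close> and Young's inequality. Subtracting |z|^2/2 turns this into a symmetric
    error of half the size.\<close>
  have "\<bar>U y - U x - (fst (m x) - x) \<bullet> (y - x)\<bar> \<le> (norm (y - x))\<^sup>2 / 2" for x y
  proof -
    have 1: "e (m y) y \<ge> e (m x) x + fst (m x) \<bullet> (y - x)"
      using max[OF m[of x], of y] by (simp add: e_def inner_simps)
    define s where "s = fst (m y) - fst (m x)"
    have "0 \<le> (norm ((y - x) - (1/2) *\<^sub>R s))\<^sup>2"
      by simp
    then have "s \<bullet> (y - x) \<le> (norm (y - x))\<^sup>2 + (norm s)\<^sup>2 / 4"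
      unfolding power2_norm_eq_inner by (simp add: inner_simps inner_commute algebra_simps)
    moreover have "e (m y) x \<le> e (m x) x - (norm s)\<^sup>2 / 4"
      using strict[OF m[of y], of x] by (simp add: s_def norm_minus_commute)
    ultimately have 2: "e (m y) y \<le> e (m x) x + fst (m x) \<bullet> (y - x) + (norm (y - x))\<^sup>2"
      by (simp add: e_def s_def inner_simps)
    have "(norm y)\<^sup>2 / 2 - (norm x)\<^sup>2 / 2 - x \<bullet> (y - x) = (norm (y - x))\<^sup>2 / 2"
      unfolding power2_norm_eq_inner by (simp add: inner_simps inner_commute field_simps)
    then show ?thesis
      using 1 2 unfolding U_def inner_diff_left by linarith
  qed
  then have "adm U"
    unfolding adm_iff_quadratic_bound by (intro exI[of _ "\<lambda>x. fst (m x) - x"]) blast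
  moreover have "v x \<le> U x" for x
    using max[OF lower[of x], of x]
    by (simp add: U_def e_def inner_simps power2_norm_eq_inner)
  moreover have "U x \<le> u x" for x
    using upper[OF m[of x], of x] by (simp add: U_def)
  ultimately show ?thesis using that by blast
qed

section \<open>Existence of an optimal potential\<close>

text \<open>Diagonal extraction on a countable dense set, followed by a three-term estimate:
  equicontinuity makes the subsequence Cauchy at every other point too.\<close>

lemma equicontinuous_pointwise_convergent_subsequence:
  fixes F :: "nat \<Rightarrow> 'a::second_countable_topology \<Rightarrow> 'b::{banach,heine_borel}"
  assumes bound: "\<And>n x. norm (F n x) \<le> B x"
    and equi: "\<And>x e. 0 < e \<Longrightarrow> \<exists>X. open X \<and> x \<in> X \<and> (\<forall>n. \<forall>y\<in>X. norm (F n y - F n x) < e)"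
  obtains k g where "strict_mono (k :: nat \<Rightarrow> nat)" "\<And>x. (\<lambda>n. F (k n) x) \<longlonglongrightarrow> g x"
proof -
  obtain Q :: "'a set" where Q: "countable Q" "\<And>X. open X \<Longrightarrow> X \<noteq> {} \<Longrightarrow> \<exists>d\<in>Q. d \<in> X"
    using countable_dense_exists by blast
  \<comment> \<open>Dividing by this positive weight turns the pointwise bound \<open>B\<close> into
    the uniform bound 1 required for the diagonal extraction; \<open>conv\<close> multiplies
    back.\<close>
  define c where "c x = 1 + \<bar>B x\<bar>" for x
  have c: "c x > 0" for x by (simp add: c_def add_pos_nonneg)
  have "norm (F n x /\<^sub>R c x) \<le> 1" for n x
    using bound[of n x] c[of x] by (simp add: c_def field_simps)
  then obtain k where k: "strict_mono (k :: nat \<Rightarrow> nat)"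
    and lim: "\<And>x. x \<in> Q \<Longrightarrow> \<exists>l. (\<lambda>n. F (k n) x /\<^sub>R c x) \<longlonglongrightarrow> l"
    using function_convergent_subsequence[OF Q(1), of "\<lambda>n x. F n x /\<^sub>R c x" 1] by blast
  have conv: "Cauchy (\<lambda>n. F (k n) x)" if xQ: "x \<in> Q" for x
  proof -
    obtain l where "(\<lambda>n. F (k n) x /\<^sub>R c x) \<longlonglongrightarrow> l"
      using lim[OF xQ] by blast
    then have "(\<lambda>n. c x *\<^sub>R (F (k n) x /\<^sub>R c x)) \<longlonglongrightarrow> c x *\<^sub>R l"
      by (intro tendsto_intros)
    then show ?thesis
      using c[of x] by (intro LIMSEQ_imp_Cauchy[of _ "c x *\<^sub>R l"]) simp
  qed
  have "Cauchy (\<lambda>n. F (k n) x)" for x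
  proof (rule metric_CauchyI)
    fix e :: real assume "0 < e"
    then obtain X where X: "open X" "x \<in> X" "\<And>n y. y \<in> X \<Longrightarrow> norm (F n y - F n x) < e / 3"
      using equi[of "e / 3" x] by auto
    then obtain y where y: "y \<in> Q" "y \<in> X"
      using Q(2)[of X] by blast
    obtain N where N: "\<And>m n. m \<ge> N \<Longrightarrow> n \<ge> N \<Longrightarrow> dist (F (k m) y) (F (k n) y) < e / 3"
      using metric_CauchyD[OF conv[OF y(1)], of "e / 3"] \<open>0 < e\<close> by auto
    have "dist (F (k m) x) (F (k n) x) < e" if "m \<ge> N" "n \<ge> N" for m n
    proof -
      have "dist (F (k m) x) (F (k n) x) \<le> dist (F (k m) x) (F (k m) y)
          + dist (F (k m) y) (F (k n) y) + dist (F (k n) y) (F (k n) x)"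
        using dist_triangle[of "F (k m) x" "F (k n) x" "F (k m) y"]
          dist_triangle[of "F (k m) y" "F (k n) x" "F (k n) y"] by linarith
      then show ?thesis
        using N[OF that] X(3)[OF y(2), of "k m"] X(3)[OF y(2), of "k n"]
        by (simp add: dist_norm norm_minus_commute)
    qed
    then show "\<exists>M. \<forall>m\<ge>M. \<forall>n\<ge>M. dist (F (k m) x) (F (k n) x) < e"
      by blast
  qed
  then have "\<exists>l. (\<lambda>n. F (k n) x) \<longlonglongrightarrow> l" for x
    by (simp add: Cauchy_convergent_iff convergent_def)
  then obtain g where "\<And>x. (\<lambda>n. F (k n) x) \<longlonglongrightarrow> g x"
    by metis
  with k show ?thesis using that by blast
qed

text \<open>Values and slopes are extracted jointly as pairs, so the limit of the slopes witnesses
  the quadratic bound for the limit of the values. The normalisation at 0 gives |D n x| \<le> |x|,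
  and with it pointwise bounds and equicontinuity independent of \<open>n\<close>.\<close>

lemma C11_convergent_subsequence:
  fixes w :: "nat \<Rightarrow> 'a::euclidean_space \<Rightarrow> real"
  assumes w: "\<And>n x y. \<bar>w n y - w n x - D n x \<bullet> (y - x)\<bar> \<le> (norm (y - x))\<^sup>2 / 2"
    and zero: "\<And>n. w n 0 = 0" "\<And>n. D n 0 = 0"
  obtains k U where "strict_mono (k :: nat \<Rightarrow> nat)" "adm U" "\<And>x. (\<lambda>n. w (k n) x) \<longlonglongrightarrow> U x"
proof -
  have lip: "norm (D n x - D n y) \<le> norm (x - y)" for n x y
    using w by (rule quadratic_bound_imp_nonexpansive)
  have D: "norm (D n x) \<le> norm x" for n x
    using lip[of n x 0] zero by simp
  define F where "F n x = (w n x, D n x)" for n x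
  have bound: "norm (F n x) \<le> (norm x)\<^sup>2 / 2 + norm x" for n x
  proof -
    have "norm (F n x) \<le> norm (w n x) + norm (D n x)"
      unfolding F_def by (rule norm_Pair_le)
    then show ?thesis
      using D[of n x] w[of n x 0] zero by simp
  qed
  have equi: "\<exists>X. open X \<and> x \<in> X \<and> (\<forall>n. \<forall>y\<in>X. norm (F n y - F n x) < e)" if "0 < e" for x and e :: real
  proof -
    define h where "h y = norm x * norm (y - x) + (norm (y - x))\<^sup>2 / 2 + norm (y - x)" for y
    have "norm (F n y - F n x) \<le> h y" for n y
    proof -
      have "norm (F n y - F n x) \<le> norm (w n y - w n x) + norm (D n y - D n x)"
        unfolding F_def by (metis diff_Pair norm_Pair_le)
      moreover have "\<bar>D n x \<bullet> (y - x)\<bar> \<le> norm x * norm (y - x)"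
        using Cauchy_Schwarz_ineq2[of "D n x" "y - x"] mult_right_mono[OF D[of n x], of "norm (y - x)"]
        by simp
      ultimately show ?thesis
        using w[of n y x] lip[of n y x] unfolding h_def real_norm_def by linarith
    qed
    moreover have "open {y. h y < e}"
      unfolding h_def by (intro open_Collect_less continuous_intros) auto
    moreover have "x \<in> {y. h y < e}"
      using that by (simp add: h_def)
    ultimately show ?thesis
      by (intro exI[of _ "{y. h y < e}"]) (auto intro: le_less_trans)
  qed
  obtain k g where k: "strict_mono (k :: nat \<Rightarrow> nat)" and g: "\<And>x. (\<lambda>n. F (k n) x) \<longlonglongrightarrow> g x"
    by (rule equicontinuous_pointwise_convergent_subsequence[OF bound equi], assumption, rule that)
  have U: "(\<lambda>n. w (k n) x) \<longlonglongrightarrow> fst (g x)" and P: "(\<lambda>n. D (k n) x) \<longlonglongrightarrow> snd (g x)" for x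
    using tendsto_fst[OF g[of x]] tendsto_snd[OF g[of x]] by (simp_all add: F_def)
  have "\<bar>fst (g y) - fst (g x) - snd (g x) \<bullet> (y - x)\<bar> \<le> (norm (y - x))\<^sup>2 / 2" for x y
  proof (rule tendsto_upperbound)
    show "(\<lambda>n. \<bar>w (k n) y - w (k n) x - D (k n) x \<bullet> (y - x)\<bar>)
        \<longlonglongrightarrow> \<bar>fst (g y) - fst (g x) - snd (g x) \<bullet> (y - x)\<bar>"
      by (intro tendsto_intros U P)
    show "\<forall>\<^sub>F n in sequentially. \<bar>w (k n) y - w (k n) x - D (k n) x \<bullet> (y - x)\<bar> \<le> (norm (y - x))\<^sup>2 / 2"
      by (intro always_eventually allI w)
  qed simp
  then have "adm (\<lambda>x. fst (g x))"
    unfolding adm_iff_quadratic_bound by (intro exI[of _ "\<lambda>x. snd (g x)"]) simp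
  with k U show ?thesis using that by blast
qed

section \<open>Integrability under finite second moments\<close>

lemma P2_prob_space: "P2 M \<Longrightarrow> prob_space M"
  by (simp add: P2_def)

lemma P2_measurable:
  fixes M :: "'a::euclidean_space measure"
  assumes "P2 M"
  shows "borel_measurable M = (borel_measurable borel :: ('a \<Rightarrow> 'b::topological_space) set)"
  using assms by (intro measurable_cong_sets) (auto simp: P2_def)

lemma P2_integrable_quadratic:
  fixes f :: "'a::euclidean_space \<Rightarrow> 'b::{banach,second_countable_topology}"
  assumes M: "P2 M" and f: "f \<in> borel_measurable borel"
    and le: "\<And>x. norm (f x) \<le> C * (1 + (norm x)\<^sup>2)"
  shows "integrable M f"
proof -
  interpret prob_space M using M by (rule P2_prob_space)
  have "integrable M (\<lambda>x. C * (1 + (norm x)\<^sup>2))"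
    using M by (auto simp: P2_def)
  then show ?thesis
    by (rule Bochner_Integration.integrable_bound)
      (use f le P2_measurable[OF M] in \<open>auto intro!: AE_I2 order_trans[OF le]\<close>)
qed

lemma norm_le_one_plus_square: "norm x \<le> 1 + (norm x)\<^sup>2"
proof -
  have "0 \<le> (norm x - 1)\<^sup>2" by simp
  then have "2 * norm x \<le> 1 + (norm x)\<^sup>2"
    unfolding power2_diff by simp
  then show ?thesis
    using norm_ge_zero[of x] by linarith
qed

lemma P2_integrable_id:
  fixes M :: "'a::euclidean_space measure"
  assumes "P2 M"
  shows "integrable M (\<lambda>x. x)"
  using assms by (rule P2_integrable_quadratic[where C=1]) (auto intro: norm_le_one_plus_square)

lemma adm_measurable:
  fixes u :: "'a::euclidean_space \<Rightarrow> real"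
  assumes "adm u"
  shows "u \<in> borel_measurable borel"
proof -
  have "continuous_on UNIV u"
    using assms unfolding adm_def
    by (meson continuous_at_imp_continuous_on has_derivative_continuous)
  then show ?thesis
    by (rule borel_measurable_continuous_onI)
qed

lemma adm_quadratic_growth:
  fixes u :: "'a::euclidean_space \<Rightarrow> real"
  assumes "adm u"
  shows "\<bar>u x\<bar> \<le> (\<bar>u 0\<bar> + norm (grad u 0) + 1) * (1 + (norm x)\<^sup>2)"
proof -
  have "\<bar>u x\<bar> \<le> \<bar>u 0\<bar> + \<bar>grad u 0 \<bullet> x\<bar> + (norm x)\<^sup>2 / 2"
    using adm_grad(1)[OF assms, of x 0] unfolding diff_zero by linarith
  moreover have "\<bar>grad u 0 \<bullet> x\<bar> \<le> norm (grad u 0) * norm x"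
    by (rule Cauchy_Schwarz_ineq2)
  moreover have "norm (grad u 0) * norm x \<le> norm (grad u 0) * (1 + (norm x)\<^sup>2)"
    by (intro mult_left_mono norm_le_one_plus_square) auto
  moreover have "\<bar>u 0\<bar> \<le> \<bar>u 0\<bar> * (1 + (norm x)\<^sup>2)"
    using mult_left_mono[of 1 "1 + (norm x)\<^sup>2" "\<bar>u 0\<bar>"] by simp
  moreover have "(norm x)\<^sup>2 / 2 \<le> 1 + (norm x)\<^sup>2"
    by (simp add: add_increasing)
  ultimately show ?thesis unfolding ring_distribs mult_1_left mult_1_right by linarith
qed

lemma adm_integrable:
  fixes u :: "'a::euclidean_space \<Rightarrow> real"
  assumes "adm u" "P2 M"
  shows "integrable M u"
  using assms(2) adm_measurable[OF assms(1)] adm_quadratic_growth[OF assms(1)]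
  by (intro P2_integrable_quadratic) auto

text \<open>Unit mass and equal barycentres make \<open>gain\<close> blind to affine functions, so
  \<open>T\<close> may remove the first-order Taylor polynomial at 0. The resulting bound |T u x|
  \<le> |x|^2/2 does double duty: it bounds the gains and dominates the sequence when passing to the
  limit.\<close>

lemma exists_gain_maximiser:
  fixes \<mu> \<nu> :: "'a::euclidean_space measure"
  assumes \<mu>: "P2 \<mu>" and \<nu>: "P2 \<nu>" and bary: "bary \<mu> = bary \<nu>"
  obtains u where "adm u" "\<And>w. adm w \<Longrightarrow> gain \<mu> \<nu> w \<le> gain \<mu> \<nu> u"
proof -
  define T where "T u x = u x - u 0 - grad u 0 \<bullet> x" for u :: "'a \<Rightarrow> real" and x
  have T: "\<bar>T u y - T u x - (grad u x - grad u 0) \<bullet> (y - x)\<bar> \<le> (norm (y - x))\<^sup>2 / 2"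
    if "adm u" for u x y
    using adm_grad(1)[OF that, of y x] by (simp add: T_def inner_simps algebra_simps)
  have T_le: "\<bar>T u x\<bar> \<le> (norm x)\<^sup>2 / 2" if "adm u" for u x
    using adm_grad(1)[OF that, of x 0] by (simp add: T_def)
  have admT: "adm (T u)" if "adm u" for u
    unfolding adm_iff_quadratic_bound using T[OF that] by (intro exI[of _ "\<lambda>x. grad u x - grad u 0"]) blast
  have T_int: "(\<integral>x. T u x \<partial>M) = (\<integral>x. u x \<partial>M) - u 0 - grad u 0 \<bullet> bary M"
    if "adm u" "P2 M" for u and M :: "'a measure"
  proof -
    interpret prob_space M using \<open>P2 M\<close> by (rule P2_prob_space)
    show ?thesis
      unfolding T_def bary_def
      using adm_integrable[OF that] P2_integrable_id[OF that(2)] by (simp add: prob_space)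
  qed
  have gainT: "gain \<mu> \<nu> (T u) = gain \<mu> \<nu> u" if "adm u" for u
    using T_int[OF that \<mu>] T_int[OF that \<nu>] bary by (simp add: gain_def)
  have half: "integrable M (\<lambda>x. (norm x)\<^sup>2 / 2)" if "P2 M" for M :: "'a measure"
    using that by (simp add: P2_def)
  define G where "G = gain \<mu> \<nu> ` Collect adm"
  have "adm (\<lambda>_::'a. 0)"
    unfolding adm_iff_quadratic_bound by (intro exI[of _ "\<lambda>_. 0"]) simp
  then have "G \<noteq> {}" by (auto simp: G_def)
  have "bdd_above G"
  proof (rule bdd_aboveI)
    fix r assume "r \<in> G"
    then obtain u where u: "adm u" "r = gain \<mu> \<nu> (T u)"
      by (auto simp: G_def gainT)
    have "\<bar>\<integral>x. T u x \<partial>M\<bar> \<le> (\<integral>x. (norm x)\<^sup>2 / 2 \<partial>M)" if "P2 M" for M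
      using T_le[OF u(1)] adm_integrable[OF admT[OF u(1)] that] half[OF that]
      by (intro order_trans[OF integral_abs_bound] integral_mono) auto
    from this[OF \<mu>] this[OF \<nu>]
    show "r \<le> (\<integral>x. (norm x)\<^sup>2 / 2 \<partial>\<mu>) + (\<integral>x. (norm x)\<^sup>2 / 2 \<partial>\<nu>)"
      by (simp add: u(2) gain_def)
  qed
  have "\<exists>u. adm u \<and> Sup G - 1 / real (Suc n) < gain \<mu> \<nu> u" for n
  proof -
    have "\<exists>r\<in>G. Sup G - 1 / real (Suc n) < r"
      using \<open>G \<noteq> {}\<close> \<open>bdd_above G\<close> by (subst less_cSup_iff[symmetric]) auto
    then show ?thesis by (auto simp: G_def)
  qed
  then obtain s where s: "\<And>n. adm (s n)" and s_gain: "\<And>n. Sup G - 1 / real (Suc n) < gain \<mu> \<nu> (s n)"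
    by metis
  have 0: "T (s n) 0 = 0" "grad (s n) 0 - grad (s n) 0 = 0" for n
    by (simp_all add: T_def)
  obtain k U where k: "strict_mono (k :: nat \<Rightarrow> nat)" and "adm U" and U: "\<And>x. (\<lambda>n. T (s (k n)) x) \<longlonglongrightarrow> U x"
    using C11_convergent_subsequence[of "\<lambda>n. T (s n)" "\<lambda>n x. grad (s n) x - grad (s n) 0"] T[OF s] 0
    by blast
  have "(\<lambda>n. \<integral>x. T (s (k n)) x \<partial>M) \<longlonglongrightarrow> (\<integral>x. U x \<partial>M)" if "P2 M" for M
    using half[OF that] U T_le[OF s]
    by (intro integral_dominated_convergence[where w="\<lambda>x. (norm x)\<^sup>2 / 2"])
      (auto simp: P2_measurable[OF that] intro!: adm_measurable admT s \<open>adm U\<close>)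
  then have "(\<lambda>n. gain \<mu> \<nu> (T (s (k n)))) \<longlonglongrightarrow> gain \<mu> \<nu> U"
    unfolding gain_def using \<mu> \<nu> by (intro tendsto_diff) auto
  moreover have "(\<lambda>n. Sup G - 1 / real (Suc n)) \<longlonglongrightarrow> Sup G - 0"
    by (intro tendsto_diff tendsto_const LIMSEQ_Suc lim_1_over_n)
  then have "((\<lambda>n. Sup G - 1 / real (Suc n)) \<circ> k) \<longlonglongrightarrow> Sup G - 0"
    using k by (rule LIMSEQ_subseq_LIMSEQ)
  moreover have "((\<lambda>n. Sup G - 1 / real (Suc n)) \<circ> k) n \<le> gain \<mu> \<nu> (T (s (k n)))" for n
    using s_gain[of "k n"] gainT[OF s, of "k n"] by simp
  ultimately have "Sup G - 0 \<le> gain \<mu> \<nu> U"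
    by (intro LIMSEQ_le[of _ _ "\<lambda>n. gain \<mu> \<nu> (T (s (k n)))"]) auto
  then have "gain \<mu> \<nu> w \<le> gain \<mu> \<nu> U" if "adm w" for w
    using cSup_upper[of "gain \<mu> \<nu> w" G] \<open>bdd_above G\<close> that by (auto simp: G_def)
  with \<open>adm U\<close> show ?thesis using that by blast
qed

section \<open>A Hahn--Banach theorem for cones\<close>

text \<open>A pair (f, r) reads as "f is worth at most r": \<open>E0\<close> acts as the epigraph of
  a sublinear functional, given by its upper bounds, and \<open>L\<close> is a linear functional
  below it. Zorn's lemma is applied to cones of pairs instead of partially defined
  functionals.\<close>

lemma linear_selection_of_cone:
  fixes E0 :: "(('b \<Rightarrow> real) \<times> real) set"
  assumes add: "\<And>f r g s. (f, r) \<in> E0 \<Longrightarrow> (g, s) \<in> E0 \<Longrightarrow> ((\<lambda>x. f x + g x), r + s) \<in> E0"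
    and scale: "\<And>f r t. (f, r) \<in> E0 \<Longrightarrow> 0 \<le> t \<Longrightarrow> ((\<lambda>x. t * f x), t * r) \<in> E0"
    and nonneg: "\<And>r. ((\<lambda>_. 0), r) \<in> E0 \<Longrightarrow> 0 \<le> r"
    and dom: "\<And>f. f \<in> V \<Longrightarrow> \<exists>r. (f, r) \<in> E0"
    and neg: "\<And>f. f \<in> V \<Longrightarrow> (\<lambda>x. - f x) \<in> V"
  obtains L where
    "\<And>f r. f \<in> V \<Longrightarrow> (f, r) \<in> E0 \<Longrightarrow> L f \<le> r"
    "\<And>f g. f \<in> V \<Longrightarrow> g \<in> V \<Longrightarrow> (\<lambda>x. f x + g x) \<in> V \<Longrightarrow> L (\<lambda>x. f x + g x) = L f + L g"
    "\<And>f t. f \<in> V \<Longrightarrow> (\<lambda>x. t * f x) \<in> V \<Longrightarrow> L (\<lambda>x. t * f x) = t * L f"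
proof (cases "V = {}")
  case True
  then show ?thesis using that by blast
next
  case False
  \<comment> \<open>The last clause is consistency: the zero function never has a negative price. It
    survives unions of chains, and with additivity it makes any heights of \<open>f\<close> and
    \<open>-f\<close> sum to a nonnegative number.\<close>
  define cone where "cone E \<longleftrightarrow> E0 \<subseteq> E \<and>
    (\<forall>f r g s. (f, r) \<in> E \<longrightarrow> (g, s) \<in> E \<longrightarrow> ((\<lambda>x. f x + g x), r + s) \<in> E) \<and>
    (\<forall>f r t. (f, r) \<in> E \<longrightarrow> 0 \<le> t \<longrightarrow> ((\<lambda>x. t * f x), t * r) \<in> E) \<and>
    (\<forall>r. ((\<lambda>_. 0), r) \<in> E \<longrightarrow> 0 \<le> r)" for E
  have "cone E0"
    unfolding cone_def using add scale nonneg by simp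
  have "\<exists>M\<in>Collect cone. \<forall>X\<in>Collect cone. M \<subseteq> X \<longrightarrow> X = M"
  proof (rule subset_Zorn_nonempty)
    show "Collect cone \<noteq> {}"
      using \<open>cone E0\<close> by blast
    fix C assume "C \<noteq> {}" and ch: "subset.chain (Collect cone) C"
    have mem: "cone E" if "E \<in> C" for E
      using ch that by (auto simp: subset.chain_def)
    have tot: "E \<subseteq> E' \<or> E' \<subseteq> E" if "E \<in> C" "E' \<in> C" for E E'
      using ch that by (auto simp: subset.chain_def)
    have "((\<lambda>x. f x + g x), r + s) \<in> \<Union>C" if fg: "(f, r) \<in> \<Union>C" "(g, s) \<in> \<Union>C" for f r g s
    proof -
      obtain E where "E \<in> C" "(f, r) \<in> E" "(g, s) \<in> E"
        using fg tot by blast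
      then show ?thesis
        using mem[OF \<open>E \<in> C\<close>] unfolding cone_def by (meson UnionI)
    qed
    moreover have "((\<lambda>x. t * f x), t * r) \<in> \<Union>C" if "(f, r) \<in> \<Union>C" "0 \<le> t" for f r t
      using that mem unfolding cone_def by blast
    moreover have "0 \<le> r" if "((\<lambda>_. 0), r) \<in> \<Union>C" for r
      using that mem unfolding cone_def by blast
    moreover have "E0 \<subseteq> \<Union>C"
      using \<open>C \<noteq> {}\<close> mem unfolding cone_def by blast
    ultimately have "cone (\<Union>C)"
      unfolding cone_def by (intro conjI allI impI)
    then show "\<Union>C \<in> Collect cone" by simp
  qed
  then obtain M where "cone M" and max: "\<And>X. cone X \<Longrightarrow> M \<subseteq> X \<Longrightarrow> X = M"
    by blast
  then have M0: "E0 \<subseteq> M"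
    and Madd: "\<And>f r g s. (f, r) \<in> M \<Longrightarrow> (g, s) \<in> M \<Longrightarrow> ((\<lambda>x. f x + g x), r + s) \<in> M"
    and Mscale: "\<And>f r t. (f, r) \<in> M \<Longrightarrow> 0 \<le> t \<Longrightarrow> ((\<lambda>x. t * f x), t * r) \<in> M"
    and Mnonneg: "\<And>r. ((\<lambda>_. 0), r) \<in> M \<Longrightarrow> 0 \<le> r"
    unfolding cone_def by simp_all
  have opp: "0 \<le> r + s" if "(f, r) \<in> M" "((\<lambda>x. - f x), s) \<in> M" for f r s
    using Mnonneg Madd[OF that] by simp
  \<comment> \<open>A maximal cone contains with \<open>f\<close> also \<open>- f\<close> at the opposite height, so it is the graph of a
    linear functional plus the half-line of nonnegative heights.\<close>
  have extend: "((\<lambda>x. - f x), - a) \<in> M"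
    if f: "(f, r0) \<in> M" and a: "\<And>r. (f, r) \<in> M \<Longrightarrow> a \<le> r" for f r0 a
  proof -
    \<comment> \<open>The cone generated by \<open>M\<close> and the new pair (-f, -a). Consistency
      holds because a pair over 0 forces g = t f; after division by t > 0 this is a height of
      \<open>f\<close> in \<open>M\<close>, which is at least \<open>a\<close>.\<close>
    define X where "X = {((\<lambda>x. g x - t * f x), s - t * a) | g s t. (g, s) \<in> M \<and> 0 \<le> t}"
    have X_I: "(h, c) \<in> X"
      if "(g, s) \<in> M" "0 \<le> t" "h = (\<lambda>x. g x - t * f x)" "c = s - t * a" for g s t h c
      using that unfolding X_def by blast
    have "M \<subseteq> X"
    proof
      fix e assume "e \<in> M"
      then show "e \<in> X"
        using X_I[of "fst e" "snd e" 0 "fst e" "snd e"] by simp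
    qed
    moreover have "cone X"
      unfolding cone_def
    proof (intro conjI allI impI)
      show "E0 \<subseteq> X"
        using M0 \<open>M \<subseteq> X\<close> by blast
    next
      fix h1 c1 h2 c2 assume "(h1, c1) \<in> X" "(h2, c2) \<in> X"
      then obtain g1 s1 t1 g2 s2 t2 where
        "(g1, s1) \<in> M" "0 \<le> t1" "h1 = (\<lambda>x. g1 x - t1 * f x)" "c1 = s1 - t1 * a"
        "(g2, s2) \<in> M" "0 \<le> t2" "h2 = (\<lambda>x. g2 x - t2 * f x)" "c2 = s2 - t2 * a"
        unfolding X_def by blast
      then show "((\<lambda>x. h1 x + h2 x), c1 + c2) \<in> X"
        by (intro X_I[OF Madd[of g1 s1 g2 s2], of "t1 + t2"]) (auto simp: algebra_simps)
    next
      fix h c and t :: real assume "(h, c) \<in> X" "0 \<le> t"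
      then obtain g s t' where
        "(g, s) \<in> M" "0 \<le> t'" "h = (\<lambda>x. g x - t' * f x)" "c = s - t' * a"
        unfolding X_def by blast
      with \<open>0 \<le> t\<close> show "((\<lambda>x. t * h x), t * c) \<in> X"
        by (intro X_I[OF Mscale[of g s t], of "t * t'"]) (auto simp: algebra_simps)
    next
      fix c assume "((\<lambda>_. 0), c) \<in> X"
      then obtain g s t where g: "(g, s) \<in> M" "0 \<le> t" "(\<lambda>_. 0) = (\<lambda>x. g x - t * f x)" "c = s - t * a"
        unfolding X_def by blast
      have g_eq: "g = (\<lambda>x. t * f x)"
      proof
        show "g x = t * f x" for x
          using fun_cong[OF g(3), of x] by simp
      qed
      show "0 \<le> c"
      proof (cases "t = 0")
        case True
        then show ?thesis using g(1,4) g_eq Mnonneg[of s] by simp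
      next
        case False
        then have "(f, s / t) \<in> M"
          using Mscale[OF g(1), of "1 / t"] g(2) by (simp add: g_eq)
        then show ?thesis
          using a[of "s / t"] g(2,4) False by (simp add: field_simps)
      qed
    qed
    ultimately have "X = M" by (intro max)
    moreover have "((\<lambda>x. - f x), - a) \<in> X"
      using Mscale[OF f, of 0] by (intro X_I[of "\<lambda>_. 0" 0 1]) auto
    ultimately show ?thesis by simp
  qed
  have ex: "\<exists>a. (f, a) \<in> M \<and> ((\<lambda>x. - f x), - a) \<in> M" if fV: "f \<in> V" for f
  proof -
    \<comment> \<open>\<open>extend\<close> is used twice. For \<open>f\<close> it gives (-f, -a).
      Since -a is in turn a lower bound for the heights of \<open>-f\<close>, it then gives (f, a),
      so the infimum is attained.\<close>
    define a where "a = Inf {r. (f, r) \<in> M}"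
    obtain r0 s0 where r0: "(f, r0) \<in> M" and s0: "((\<lambda>x. - f x), s0) \<in> M"
      using dom[OF fV] dom[OF neg[OF fV]] M0 by blast
    have "bdd_below {r. (f, r) \<in> M}"
      using opp[OF _ s0] by (intro bdd_belowI[of _ "- s0"]) force
    then have a: "a \<le> r" if "(f, r) \<in> M" for r
      unfolding a_def using that by (intro cInf_lower) auto
    have 1: "((\<lambda>x. - f x), - a) \<in> M"
      using r0 a by (rule extend)
    have "- a \<le> s" if "((\<lambda>x. - f x), s) \<in> M" for s
    proof -
      have "- s \<le> a"
        unfolding a_def using r0 opp[OF _ that] by (intro cInf_greatest) force+
      then show ?thesis by simp
    qed
    from extend[OF s0 this] have "(f, a) \<in> M" by simp
    with 1 show ?thesis by blast
  qed
  have uniq: "a = b" if "(f, a) \<in> M" "((\<lambda>x. - f x), - a) \<in> M" "(f, b) \<in> M" "((\<lambda>x. - f x), - b) \<in> M" for f a b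
    using opp[OF that(1,4)] opp[OF that(3,2)] by simp
  obtain L where L: "\<And>f. f \<in> V \<Longrightarrow> (f, L f) \<in> M" "\<And>f. f \<in> V \<Longrightarrow> ((\<lambda>x. - f x), - L f) \<in> M"
    using ex by metis
  show ?thesis
  proof (rule that[of L])
    show "L f \<le> r" if "f \<in> V" "(f, r) \<in> E0" for f r
      using opp[OF _ L(2)[OF that(1)], of r] that(2) M0 by auto
  next
    fix f g assume fg: "f \<in> V" "g \<in> V" "(\<lambda>x. f x + g x) \<in> V"
    show "L (\<lambda>x. f x + g x) = L f + L g"
    proof (rule uniq)
      show "((\<lambda>x. - (f x + g x)), - (L f + L g)) \<in> M"
        using Madd[OF L(2)[OF fg(1)] L(2)[OF fg(2)]] by simp
    qed (rule L(1)[OF fg(3)] L(2)[OF fg(3)] Madd[OF L(1)[OF fg(1)] L(1)[OF fg(2)]])+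
  next
    fix f and t :: real assume f: "f \<in> V" "(\<lambda>x. t * f x) \<in> V"
    show "L (\<lambda>x. t * f x) = t * L f"
    proof (rule uniq)
      show "(\<lambda>x. t * f x, t * L f) \<in> M"
        using Mscale[OF L(1)[OF f(1)], of t] Mscale[OF L(2)[OF f(1)], of "- t"] by (cases "t \<ge> 0") auto
      show "(\<lambda>x. - (t * f x), - (t * L f)) \<in> M"
        using Mscale[OF L(2)[OF f(1)], of t] Mscale[OF L(1)[OF f(1)], of "- t"] by (cases "t \<ge> 0") auto
    qed (rule L(1)[OF f(2)] L(2)[OF f(2)])+
  qed
qed

section \<open>Smooth bump functions\<close>

text \<open>The classical function exp(-1/t), extended by zero, with a polynomial in 1/t as
  prefactor. The prefactor closes the family under differentiation: \<open>P\<close> is replaced by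
  X^2 (P - P').\<close>

definition flat :: "real poly \<Rightarrow> real \<Rightarrow> real" where
  "flat P t = (if t \<le> 0 then 0 else poly P (inverse t) * exp (- inverse t))"

lemma flat_tendsto_0: "(flat P \<longlongrightarrow> 0) (at 0)"
proof -
  have "((\<lambda>s. poly P s * exp (- s)) \<longlongrightarrow> (\<Sum>i\<le>degree P. coeff P i * 0)) at_top"
  proof -
    have "(\<lambda>s::real. poly P s * exp (- s)) = (\<lambda>s. \<Sum>i\<le>degree P. coeff P i * (s ^ i / exp s))"
      by (simp add: poly_altdef sum_distrib_right exp_minus divide_inverse mult.assoc)
    then show ?thesis
      by (simp only:) (intro tendsto_sum tendsto_mult tendsto_const tendsto_power_div_exp_0)
  qed
  then have "((\<lambda>t. poly P (inverse t) * exp (- inverse t)) \<longlongrightarrow> 0) (at_right 0)"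
    by (intro filterlim_compose[OF _ filterlim_inverse_at_top_right]) simp
  moreover have "\<forall>\<^sub>F t in at_right 0. poly P (inverse t) * exp (- inverse t) = flat P t"
    by (auto simp: eventually_at_filter flat_def)
  ultimately have "(flat P \<longlongrightarrow> 0) (at_right 0)"
    by (rule Lim_transform_eventually)
  moreover have "(flat P \<longlongrightarrow> 0) (at_left 0)"
    by (rule Lim_transform_eventually[OF tendsto_const]) (auto simp: eventually_at_filter flat_def)
  ultimately show ?thesis
    by (simp add: filterlim_split_at)
qed

lemma flat_has_derivative:
  "(flat P has_real_derivative flat ([:0, 0, 1:] * (P - pderiv P)) t) (at t)"
proof -
  consider "t < 0" | "t = 0" | "t > 0" by linarith
  then show ?thesis
  proof cases
    case 1
    have "((\<lambda>_. 0) has_real_derivative 0) (at t)" by simp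
    then have "(flat P has_real_derivative 0) (at t)"
      by (rule DERIV_cong_ev[THEN iffD1, OF refl _ refl, rotated])
        (use 1 in \<open>auto simp: flat_def eventually_nhds intro!: exI[of _ "{..<0}"]\<close>)
    then show ?thesis using 1 by (simp add: flat_def)
  next
    case 2
    \<comment> \<open>The difference quotient at 0 is again flat, with \<open>P\<close> multiplied
      by the variable, so its limit is a case of \<open>flat_tendsto_0\<close>.\<close>
    have "(\<lambda>h. (flat P (0 + h) - flat P 0) / h) = flat (pCons 0 P)"
      by (auto simp: fun_eq_iff flat_def field_simps)
    then show ?thesis
      using 2 flat_tendsto_0 by (simp add: DERIV_def flat_def[of _ 0])
  next
    case 3
    have "((\<lambda>t. poly P (inverse t) * exp (- inverse t)) has_real_derivative
        poly ([:0, 0, 1:] * (P - pderiv P)) (inverse t) * exp (- inverse t)) (at t)"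
      using 3
      by (auto intro!: derivative_eq_intros DERIV_chain2[OF poly_DERIV] simp: field_simps power2_eq_square)
    then have "(flat P has_real_derivative poly ([:0, 0, 1:] * (P - pderiv P)) (inverse t) * exp (- inverse t)) (at t)"
      by (rule DERIV_cong_ev[THEN iffD1, OF refl _ refl, rotated])
        (use 3 in \<open>auto simp: flat_def eventually_nhds intro!: exI[of _ "{0<..}"]\<close>)
    then show ?thesis using 3 by (simp add: flat_def)
  qed
qed

text \<open>Closed under directional derivatives, hence a witness for \<^const>\<open>smooth\<close>.\<close>

inductive flat_algebra :: "('a::euclidean_space \<Rightarrow> real) \<Rightarrow> bool" where
  const: "flat_algebra (\<lambda>_. c)"
| flat: "flat_algebra (\<lambda>x. flat P (c + w \<bullet> x))"
| add: "flat_algebra f \<Longrightarrow> flat_algebra g \<Longrightarrow> flat_algebra (\<lambda>x. f x + g x)"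
| mult: "flat_algebra f \<Longrightarrow> flat_algebra g \<Longrightarrow> flat_algebra (\<lambda>x. f x * g x)"

lemma flat_algebra_prod:
  assumes "finite I" "\<And>i. i \<in> I \<Longrightarrow> flat_algebra (f i)"
  shows "flat_algebra (\<lambda>x. \<Prod>i\<in>I. f i x)"
  using assms by (induction I rule: finite_induct) (auto intro: flat_algebra.intros)

lemma continuous_on_flat: "continuous_on UNIV (flat P)"
  using flat_has_derivative by (auto intro!: DERIV_continuous_on[where D="\<lambda>t. flat ([:0, 0, 1:] * (P - pderiv P)) t"])

lemma flat_algebra_continuous: "flat_algebra f \<Longrightarrow> continuous_on UNIV f"
proof (induction rule: flat_algebra.induct)
  case (flat P c w)
  show ?case
    by (rule continuous_on_compose2[OF continuous_on_flat]) (auto intro!: continuous_intros)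
qed (auto intro!: continuous_intros)

lemma flat_algebra_deriv:
  fixes f :: "'a::euclidean_space \<Rightarrow> real"
  assumes "flat_algebra f"
  shows "\<exists>f'. flat_algebra f' \<and> (\<forall>x. ((\<lambda>t. f (x + t *\<^sub>R b)) has_real_derivative f' x) (at 0))"
  using assms
proof (induction rule: flat_algebra.induct)
  case (const c)
  show ?case by (intro exI[of _ "\<lambda>_. 0"]) (auto intro: flat_algebra.intros)
next
  case (flat P c w)
  let ?Q = "[:0, 0, 1:] * (P - pderiv P)"
  have "((\<lambda>t. flat P (c + w \<bullet> (x + t *\<^sub>R b))) has_real_derivative flat ?Q (c + w \<bullet> x) * (w \<bullet> b)) (at 0)" for x
  proof (rule DERIV_chain2[of "flat P"])
    show "(flat P has_real_derivative flat ?Q (c + w \<bullet> x)) (at (c + w \<bullet> (x + 0 *\<^sub>R b)))"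
      using flat_has_derivative[of P "c + w \<bullet> x"] by simp
    show "((\<lambda>t. c + w \<bullet> (x + t *\<^sub>R b)) has_real_derivative w \<bullet> b) (at 0)"
      unfolding inner_add_right inner_scaleR_right by (auto intro!: derivative_eq_intros)
  qed
  moreover have "flat_algebra (\<lambda>x. flat ?Q (c + w \<bullet> x) * (w \<bullet> b))"
    by (intro flat_algebra.intros)
  ultimately show ?case by blast
next
  case (add f g)
  then obtain f' g' where
    "flat_algebra f'" "\<And>x. ((\<lambda>t. f (x + t *\<^sub>R b)) has_real_derivative f' x) (at 0)"
    "flat_algebra g'" "\<And>x. ((\<lambda>t. g (x + t *\<^sub>R b)) has_real_derivative g' x) (at 0)"
    by blast
  then show ?case
    by (intro exI[of _ "\<lambda>x. f' x + g' x"]) (auto intro: flat_algebra.intros DERIV_add)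
next
  case (mult f g)
  then obtain f' g' where d:
    "flat_algebra f'" "\<And>x. ((\<lambda>t. f (x + t *\<^sub>R b)) has_real_derivative f' x) (at 0)"
    "flat_algebra g'" "\<And>x. ((\<lambda>t. g (x + t *\<^sub>R b)) has_real_derivative g' x) (at 0)"
    by blast
  have "((\<lambda>t. f (x + t *\<^sub>R b) * g (x + t *\<^sub>R b)) has_real_derivative f' x * g x + g' x * f x) (at 0)" for x
    using DERIV_mult[OF d(2) d(4), of x x] by simp
  with d(1,3) mult.hyps show ?case
    by (intro exI[of _ "\<lambda>x. f' x * g x + g' x * f x"]) (auto intro: flat_algebra.intros)
qed

lemma flat_algebra_smooth:
  fixes f :: "'a::euclidean_space \<Rightarrow> real" and e :: "'b::real_normed_vector"
  assumes "flat_algebra f"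
  shows "smooth (\<lambda>x. f x *\<^sub>R e)"
  unfolding smooth_def
proof (intro exI[of _ "{(\<lambda>x. f x *\<^sub>R e) | f. flat_algebra f}"] conjI ballI)
  show "(\<lambda>x. f x *\<^sub>R e) \<in> {(\<lambda>x. f x *\<^sub>R e) | f. flat_algebra f}"
    using assms by blast
next
  fix g assume "g \<in> {(\<lambda>x. f x *\<^sub>R e) | f. flat_algebra (f :: 'a \<Rightarrow> real)}"
  then obtain h where h: "g = (\<lambda>x. h x *\<^sub>R e)" "flat_algebra h" by blast
  show "continuous_on UNIV g"
    unfolding h(1) using flat_algebra_continuous[OF h(2)] by (intro continuous_intros)
next
  fix g and b :: 'a assume "g \<in> {(\<lambda>x. f x *\<^sub>R e) | f. flat_algebra (f :: 'a \<Rightarrow> real)}"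
  then obtain h where h: "g = (\<lambda>x. h x *\<^sub>R e)" "flat_algebra h" by blast
  obtain h' where h': "flat_algebra h'" "\<And>x. ((\<lambda>t. h (x + t *\<^sub>R b)) has_real_derivative h' x) (at 0)"
    using flat_algebra_deriv[OF h(2)] by blast
  have "((\<lambda>t. g (x + t *\<^sub>R b)) has_vector_derivative h' x *\<^sub>R e) (at 0)" for x
    using has_vector_derivative_scaleR[OF h'(2) has_vector_derivative_const, of x e]
    by (simp add: h(1))
  with h'(1) show "\<exists>g'\<in>{(\<lambda>x. f x *\<^sub>R e) | f. flat_algebra f}.
      \<forall>x. ((\<lambda>t. g (x + t *\<^sub>R b)) has_vector_derivative g' x) (at 0)"
    by (intro bexI[of _ "\<lambda>x. h' x *\<^sub>R e"]) auto
qed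

text \<open>\<open>n\<close> is a sharpening parameter: for t > 0 the factor
  \<open>flat 1 (n * t)\<close> equals exp(-1/(n t)) when n > 0 and tends to 1, so these smooth
  functions supported in the closed box converge to the indicator of the open box.\<close>

definition box_bump :: "nat \<Rightarrow> 'a::euclidean_space \<Rightarrow> 'a \<Rightarrow> 'a \<Rightarrow> real" where
  "box_bump n a b x = (\<Prod>i\<in>Basis. flat 1 (real n * (x \<bullet> i - a \<bullet> i)) * flat 1 (real n * (b \<bullet> i - x \<bullet> i)))"

lemma box_bump_flat_algebra: "flat_algebra (box_bump n a b)"
proof -
  have "flat_algebra (\<lambda>x. \<Prod>i\<in>Basis. flat 1 (- (real n * (a \<bullet> i)) + (real n *\<^sub>R i) \<bullet> x)
      * flat 1 (real n * (b \<bullet> i) + (- real n *\<^sub>R i) \<bullet> x))"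
    by (intro flat_algebra_prod flat_algebra.intros) auto
  also have "(\<lambda>x. \<Prod>i\<in>Basis. flat 1 (- (real n * (a \<bullet> i)) + (real n *\<^sub>R i) \<bullet> x)
      * flat 1 (real n * (b \<bullet> i) + (- real n *\<^sub>R i) \<bullet> x)) = box_bump n a b"
    by (auto simp: box_bump_def fun_eq_iff algebra_simps inner_commute intro!: prod.cong)
  finally show ?thesis .
qed

lemma flat_1_bounds: "0 \<le> flat 1 t" "flat 1 t \<le> 1"
  by (auto simp: flat_def)

lemma box_bump_bounds: "0 \<le> box_bump n a b x" "box_bump n a b x \<le> 1"
  unfolding box_bump_def
  by (auto intro!: prod_nonneg prod_le_1 mult_nonneg_nonneg mult_le_one flat_1_bounds)

lemma box_bump_eq_0:
  assumes "x \<notin> box a b"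
  shows "box_bump n a b x = 0"
proof -
  from assms obtain i where "i \<in> Basis" "x \<bullet> i \<le> a \<bullet> i \<or> b \<bullet> i \<le> x \<bullet> i"
    unfolding mem_box by force
  then have "flat 1 (real n * (x \<bullet> i - a \<bullet> i)) * flat 1 (real n * (b \<bullet> i - x \<bullet> i)) = 0"
    by (auto simp: flat_def mult_le_0_iff)
  with \<open>i \<in> Basis\<close> show ?thesis
    unfolding box_bump_def by (intro prod_zero) auto
qed

lemma flat_1_tendsto:
  assumes "t > 0"
  shows "(\<lambda>n. flat 1 (real n * t)) \<longlonglongrightarrow> 1"
proof -
  have "(\<lambda>n. exp (- (inverse (real n) * inverse t))) \<longlonglongrightarrow> exp (- (0 * inverse t))"
    by (intro tendsto_intros LIMSEQ_inverse_real_of_nat[THEN LIMSEQ_imp_Suc])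
  moreover have "\<forall>\<^sub>F n in sequentially. exp (- (inverse (real n) * inverse t)) = flat 1 (real n * t)"
    using eventually_gt_at_top[of 0] by eventually_elim (use assms in \<open>auto simp: flat_def mult_le_0_iff\<close>)
  ultimately show ?thesis
    by (simp add: Lim_transform_eventually)
qed

lemma box_bump_tendsto: "(\<lambda>n. box_bump n a b x) \<longlonglongrightarrow> indicator (box a b) x"
proof (cases "x \<in> box a b")
  case True
  then have "(\<lambda>n. box_bump n a b x) \<longlonglongrightarrow> (\<Prod>i\<in>(Basis::'a set). 1 * 1)"
    unfolding box_bump_def by (intro tendsto_prod tendsto_mult flat_1_tendsto) (auto simp: mem_box)
  with True show ?thesis by simp
next
  case False
  then show ?thesis by (simp add: box_bump_eq_0)
qed

lemma box_bump_compact_support: "compact_support (\<lambda>x. box_bump n a b x *\<^sub>R e)"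
proof -
  have "{x. box_bump n a b x *\<^sub>R e \<noteq> 0} \<subseteq> box a b"
    using box_bump_eq_0 by fastforce
  then have "bounded {x. box_bump n a b x *\<^sub>R e \<noteq> 0}"
    using bounded_box bounded_subset by blast
  then show ?thesis
    unfolding compact_support_def compact_eq_bounded_closed by (simp add: bounded_closure)
qed

lemma box_bump_measurable: "box_bump n a b \<in> borel_measurable borel"
  by (rule borel_measurable_continuous_onI[OF flat_algebra_continuous[OF box_bump_flat_algebra]])

section \<open>Smooth bumps as a determining class\<close>

lemma measure_eqI_box_bump:
  fixes M N :: "'a::euclidean_space measure"
  assumes "finite_measure M" "finite_measure N" and sets: "sets M = sets borel" "sets N = sets borel"
    and eq: "\<And>n a b. (\<integral>x. box_bump n a b x \<partial>M) = (\<integral>x. box_bump n a b x \<partial>N)"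
  shows "M = N"
proof -
  interpret M: finite_measure M by fact
  interpret N: finite_measure N by fact
  have meas: "borel_measurable M = (borel_measurable borel :: ('a \<Rightarrow> real) set)"
    "borel_measurable N = (borel_measurable borel :: ('a \<Rightarrow> real) set)"
    using sets by (intro measurable_cong_sets; simp)+
  have lim: "(\<lambda>n. \<integral>x. box_bump n a b x \<partial>K) \<longlonglongrightarrow> measure K (box a b)"
    if "finite_measure K" "sets K = sets borel" for K :: "'a measure" and a b
  proof -
    interpret K: finite_measure K by fact
    have "borel_measurable K = (borel_measurable borel :: ('a \<Rightarrow> real) set)"
      using that(2) by (intro measurable_cong_sets; simp)
    moreover have "box a b \<in> sets K"
      using that(2) by simp
    ultimately have "(\<lambda>n. \<integral>x. box_bump n a b x \<partial>K) \<longlonglongrightarrow> (\<integral>x. indicator (box a b) x \<partial>K)"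
      by (intro integral_dominated_convergence[where w="\<lambda>_. 1"])
        (auto simp: box_bump_bounds intro!: box_bump_measurable AE_I2 box_bump_tendsto)
    then show ?thesis
      using \<open>box a b \<in> sets K\<close> by simp
  qed
  have box: "measure M (box a b) = measure N (box a b)" for a b
    using lim[of M a b] lim[of N a b] assms by (auto intro: LIMSEQ_unique)
  show ?thesis
  proof (rule measure_eqI_generator_eq)
    let ?E = "range (\<lambda>(a, b). box a b::'a set)"
    show "Int_stable ?E"
      by (auto simp: Int_stable_def box_Int_box)
    show "?E \<subseteq> Pow UNIV" "sets M = sigma_sets UNIV ?E" "sets N = sigma_sets UNIV ?E"
      by (simp_all add: borel_eq_box sets)
    let ?A = "\<lambda>n::nat. box (- (real n *\<^sub>R One)) (real n *\<^sub>R One) :: 'a set"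
    show "range ?A \<subseteq> ?E" "(\<Union>i. ?A i) = UNIV"
      unfolding UN_box_eq_UNIV by auto
    show "emeasure M (?A i) \<noteq> \<infinity>" for i
      by simp
    show "emeasure M X = emeasure N X" if "X \<in> ?E" for X
      using that box by (auto simp: M.emeasure_eq_measure N.emeasure_eq_measure)
  qed
qed

text \<open>The hypothesis \<open>test\<close> says that the conditional expectation of
  \<open>k\<close> given \<open>X\<close> vanishes. \<open>N 1\<close> and \<open>N (-1)\<close> are
  the images under \<open>X\<close> of the positive and negative parts of \<open>k\<close>; they
  agree on bumps, hence are equal, and integrate \<open>g\<close> to the same number.\<close>

lemma integral_weighted_eq_0:
  fixes X :: "'b \<Rightarrow> 'a::euclidean_space" and k :: "'b \<Rightarrow> real"
  assumes X[measurable]: "X \<in> measurable M borel" and k: "integrable M k"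
    and test: "\<And>n a b. (\<integral>x. k x * box_bump n a b (X x) \<partial>M) = 0"
    and g[measurable]: "g \<in> borel_measurable borel" and kg: "integrable M (\<lambda>x. k x * g (X x))"
  shows "(\<integral>x. k x * g (X x) \<partial>M) = 0"
proof -
  define N where "N s = distr (density M (\<lambda>x. ennreal (max 0 (s * k x)))) borel X" for s
  have [measurable]: "k \<in> borel_measurable M"
    using k by simp
  have int: "(\<integral>x. h x \<partial>N s) = (\<integral>x. max 0 (s * k x) * h (X x) \<partial>M)"
    if [measurable]: "h \<in> borel_measurable borel" for h :: "'a \<Rightarrow> real" and s
    unfolding N_def by (subst integral_distr, simp, simp, subst integral_density) auto
  have diff: "(\<integral>x. h x \<partial>N 1) - (\<integral>x. h x \<partial>N (- 1)) = (\<integral>x. k x * h (X x) \<partial>M)"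
    if [measurable]: "h \<in> borel_measurable borel" and kh: "integrable M (\<lambda>x. k x * h (X x))" for h
  proof -
    have i: "integrable M (\<lambda>x. max 0 (s * k x) * h (X x))" if "\<bar>s\<bar> = 1" for s
      using kh
    proof (rule Bochner_Integration.integrable_bound)
      have "\<bar>max 0 (s * k x)\<bar> \<le> \<bar>k x\<bar>" for x
        using abs_mult[of s "k x"] that by simp
      then show "AE x in M. norm (max 0 (s * k x) * h (X x)) \<le> norm (k x * h (X x))"
        by (auto simp: abs_mult intro!: mult_right_mono)
    qed measurable
    have "(\<integral>x. h x \<partial>N 1) - (\<integral>x. h x \<partial>N (- 1))
        = (\<integral>x. max 0 (1 * k x) * h (X x) - max 0 (- 1 * k x) * h (X x) \<partial>M)"
      unfolding int[OF that(1)] by (intro Bochner_Integration.integral_diff[symmetric] i) auto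
    also have "\<dots> = (\<integral>x. k x * h (X x) \<partial>M)"
      by (intro Bochner_Integration.integral_cong) (auto simp: max_def)
    finally show ?thesis .
  qed
  have fin: "finite_measure (N s)" if "\<bar>s\<bar> = 1" for s
  proof (rule finite_measureI)
    have "integrable M (\<lambda>x. max 0 (s * k x))"
      using k by auto
    then have "(\<integral>\<^sup>+ x. ennreal (max 0 (s * k x)) \<partial>M) < \<infinity>"
      by (subst (asm) integrable_iff_bounded) (auto simp: max_def)
    moreover have "emeasure (N s) (space (N s)) = (\<integral>\<^sup>+ x. ennreal (max 0 (s * k x)) \<partial>M)"
      unfolding N_def
      by (subst emeasure_distr) (auto simp: emeasure_density intro!: nn_integral_cong)
    ultimately show "emeasure (N s) (space (N s)) \<noteq> \<infinity>"
      by simp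
  qed
  have "N 1 = N (- 1)"
  proof (rule measure_eqI_box_bump)
    show "(\<integral>x. box_bump n a b x \<partial>N 1) = (\<integral>x. box_bump n a b x \<partial>N (- 1))" for n a b
    proof -
      have [measurable]: "(\<lambda>x. box_bump n a b (X x)) \<in> borel_measurable M"
        using X box_bump_measurable by (rule measurable_compose)
      have "integrable M (\<lambda>x. k x * box_bump n a b (X x))"
        using k by (rule Bochner_Integration.integrable_bound)
          (auto simp: abs_mult box_bump_bounds intro!: mult_left_le)
      from diff[OF box_bump_measurable this] test show ?thesis by simp
    qed
  qed (simp_all add: fin, simp_all add: N_def)
  then show ?thesis
    using diff[OF g kg] by simp
qed

section \<open>A space-filling curve\<close>

text \<open>Distinguishes a leading ternary digit 0 from 2: it vanishes on [0, 1/3] and is 1 on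
  [2/3, 1], as cos(pi/3) = 1/2 and cos(2 pi/3) = -1/2. The cosine makes it continuous and
  2-periodic.\<close>

definition plateau :: "real \<Rightarrow> real" where
  "plateau t = max 0 (min 1 (1 / 2 - cos (pi * t)))"

lemma plateau_bounds: "0 \<le> plateau t" "plateau t \<le> 1"
  by (auto simp: plateau_def)

lemma continuous_on_plateau: "continuous_on UNIV plateau"
  unfolding plateau_def by (intro continuous_intros)

lemma cos_shift_even: "cos (pi * (t + 2 * real n)) = cos (pi * t)"
proof -
  have "pi * (t + 2 * real n) = pi * t + 2 * real n * pi"
    by (simp add: algebra_simps)
  then show ?thesis
    by (simp only: cos_add cos_2npi sin_2npi)
qed

lemma plateau_periodic: "plateau (t + 2 * real n) = plateau t"
proof -
  have "cos (pi * (t + 2 * real n)) = cos (pi * t)"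
    by (rule cos_shift_even)
  then show ?thesis by (simp add: plateau_def)
qed

lemma plateau_0:
  assumes "0 \<le> t" "t \<le> 1 / 3"
  shows "plateau t = 0"
proof -
  have "cos (pi / 3) \<le> cos (pi * t)"
    using assms by (intro cos_monotone_0_pi_le) (auto simp: mult_left_le field_simps)
  then show ?thesis by (simp add: plateau_def cos_60)
qed

lemma plateau_1:
  assumes "2 / 3 \<le> t" "t \<le> 1"
  shows "plateau t = 1"
proof -
  have "cos (pi * t) \<le> cos (2 / 3 * pi)"
    using assms by (intro cos_monotone_0_pi_le) (auto simp: mult_left_le)
  then show ?thesis by (simp add: plateau_def cos_120)
qed

lemma binary_expansion:
  fixes c :: real
  assumes "0 \<le> c" "c \<le> 1"
  obtains a :: "nat \<Rightarrow> real" where "\<And>k. a k \<in> {0, 1}" "(\<lambda>k. (1/2) ^ Suc k * a k) sums c"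
proof -
  define d :: "real \<Rightarrow> real" where "d x = (if x \<ge> 1 / 2 then 1 else 0)" for x
  \<comment> \<open>The orbit of \<open>c\<close> under doubling modulo the digit;
    \<open>X n\<close>, scaled by 2^(-n), is the remainder after \<open>n\<close> digits. The point
    1 is fixed and has all digits 1.\<close>
  define X where "X = rec_nat c (\<lambda>_ x. 2 * x - d x)"
  have X_simps: "X 0 = c" "X (Suc k) = 2 * X k - d (X k)" for k
    by (simp_all add: X_def)
  have X: "0 \<le> X k \<and> X k \<le> 1" for k
    by (induction k) (use assms in \<open>auto simp: X_simps d_def\<close>)
  have part: "(\<Sum>k<n. (1/2) ^ Suc k * d (X k)) = c - (1/2) ^ n * X n" for n
    by (induction n) (auto simp: X_simps field_simps)
  have "(\<lambda>n. (1/2) ^ n * X n) \<longlonglongrightarrow> 0"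
  proof (rule tendsto_sandwich[OF _ _ tendsto_const])
    show "(\<lambda>n. (1/2::real) ^ n) \<longlonglongrightarrow> 0"
      by (rule LIMSEQ_power_zero) simp
    show "\<forall>\<^sub>F n in sequentially. 0 \<le> (1/2) ^ n * X n"
      "\<forall>\<^sub>F n in sequentially. (1/2) ^ n * X n \<le> (1/2) ^ n"
      using X by (auto intro!: always_eventually mult_left_le)
  qed
  then have "(\<lambda>n. c - (1/2) ^ n * X n) \<longlonglongrightarrow> c - 0"
    by (intro tendsto_intros)
  then have "(\<lambda>k. (1/2) ^ Suc k * d (X k)) sums c"
    by (simp only: sums_def part diff_zero)
  moreover have "d (X k) \<in> {0, 1}" for k
    by (simp add: d_def)
  ultimately show ?thesis using that[of "\<lambda>k. d (X k)"] by blast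
qed

text \<open>Take \<open>t\<close> with ternary digits 2 b j. Multiplication by 3^m leaves the tail
  \<open>T m\<close> plus an even integer, which the period absorbs, and 3 T m = 2 b m + T (m+1)
  puts the tail in [0, 1/3] or [2/3, 1] according to \<open>b m\<close>.\<close>

lemma plateau_digits:
  fixes b :: "nat \<Rightarrow> real"
  assumes b: "\<And>j. b j \<in> {0, 1}"
  obtains t where "0 \<le> t" "t \<le> 1" "\<And>m. plateau (3 ^ m * t) = b m"
proof -
  define T where "T m = (\<Sum>j. 2 * b (j + m) * (1/3) ^ Suc j)" for m
  have geo: "(\<lambda>j. 2 * (1/3) ^ Suc j) sums (1::real)"
    using sums_mult[OF geometric_sums[of "1/3::real"], of "2/3"] by (simp add: field_simps)
  have b01: "0 \<le> b j" "b j \<le> 1" for j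
    using b[of j] by auto
  have sm: "summable (\<lambda>j. 2 * b (j + m) * (1/3) ^ Suc j)" for m
    by (rule summable_comparison_test'[OF sums_summable[OF geo], of 0])
      (use b01 in \<open>auto simp: abs_mult intro!: mult_right_mono\<close>)
  have T: "0 \<le> T m" "T m \<le> 1" for m
  proof -
    show "0 \<le> T m"
      unfolding T_def by (intro suminf_nonneg sm) (use b01 in auto)
    have "T m \<le> (\<Sum>j. 2 * (1/3) ^ Suc j)"
      unfolding T_def by (intro suminf_le sm sums_summable[OF geo]) (use b01 in \<open>auto intro!: mult_right_mono\<close>)
    then show "T m \<le> 1"
      using sums_unique[OF geo] by simp
  qed
  have rec: "3 * T m = 2 * b m + T (Suc m)" for m
  proof -
    have "T m = (\<Sum>j. 2 * b (Suc j + m) * (1/3) ^ Suc (Suc j)) + 2 * b m * (1/3)"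
      using suminf_split_head[OF sm[of m]] by (simp add: T_def)
    also have "(\<Sum>j. 2 * b (Suc j + m) * (1/3) ^ Suc (Suc j)) = (\<Sum>j. (1/3) * (2 * b (j + Suc m) * (1/3) ^ Suc j))"
      by (intro suminf_cong) (simp add: algebra_simps)
    also have "\<dots> = (1/3) * T (Suc m)"
      unfolding T_def by (intro suminf_mult sm)
    finally show ?thesis by simp
  qed
  have "\<exists>n::nat. 3 ^ m * T 0 = T m + 2 * real n" for m
  proof (induction m)
    case 0
    show ?case by (intro exI[of _ 0]) simp
  next
    case (Suc m)
    then obtain n where n: "3 ^ m * T 0 = T m + 2 * real n" by blast
    obtain d :: nat where "b m = real d"
      using b[of m] by (metis insertE of_nat_0 of_nat_1 singletonD)
    then have "3 ^ Suc m * T 0 = T (Suc m) + 2 * real (3 * n + d)"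
      using n rec[of m] by simp
    then show ?case by blast
  qed
  then have "plateau (3 ^ m * T 0) = plateau (T m)" for m
    by (metis plateau_periodic)
  moreover have "plateau (T m) = b m" for m
  proof (cases "b m = 0")
    case True
    then show ?thesis
      using rec[of m] T[of "Suc m"] by (auto intro!: plateau_0)
  next
    case False
    then have "b m = 1" using b[of m] by simp
    then show ?thesis
      using rec[of m] T[of "Suc m"] by (auto intro!: plateau_1)
  qed
  ultimately show ?thesis using that[of "T 0"] T[of 0] by simp
qed

text \<open>Schoenberg's curve: on ternary expansions with digits 0 and 2, the coordinate \<open>i\<close> reads off the
  digits at positions congruent to \<open>r i\<close> modulo the dimension as a binary expansion.\<close>

lemma cube_filling_curve:
  obtains g :: "'a::euclidean_space \<Rightarrow> real \<Rightarrow> real" where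
    "\<And>i. continuous_on UNIV (g i)"
    "\<And>i t n. g i (t + 2 * real n) = g i t"
    "\<And>c. (\<And>i. 0 \<le> c i \<and> c i \<le> 1) \<Longrightarrow> \<exists>t\<in>{0..1}. \<forall>i\<in>Basis. g i t = c i"
proof -
  obtain r where r: "bij_betw r (Basis::'a set) {0..<DIM('a)}"
    using ex_bij_betw_finite_nat[OF finite_Basis] by blast
  define g where "g i t = (\<Sum>k. (1/2) ^ Suc k * plateau (3 ^ (DIM('a) * k + r i) * t))" for i t
  show ?thesis
  proof (rule that[of g])
    fix i :: 'a
    have "uniform_limit UNIV (\<lambda>n t. \<Sum>k<n. (1/2) ^ Suc k * plateau (3 ^ (DIM('a) * k + r i) * t)) (g i) sequentially"
      unfolding g_def
    proof (rule Weierstrass_m_test)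
      show "summable (\<lambda>k. (1/2::real) ^ Suc k)"
        by (intro summable_geometric[THEN summable_Suc_iff[THEN iffD2]]) simp
      show "norm ((1/2) ^ Suc k * plateau (3 ^ (DIM('a) * k + r i) * t)) \<le> (1/2) ^ Suc k" for k t
        using plateau_bounds by (simp add: abs_mult)
    qed
    then show "continuous_on UNIV (g i)"
      by (rule uniform_limit_theorem[rotated])
        (auto intro!: always_eventually continuous_intros continuous_on_compose2[OF continuous_on_plateau])
  next
    fix i t n
    have "plateau (3 ^ m * (t + 2 * real n)) = plateau (3 ^ m * t)" for m
      using plateau_periodic[of "3 ^ m * t" "3 ^ m * n"] by (simp add: algebra_simps)
    then show "g i (t + 2 * real n) = g i t"
      by (simp add: g_def)
  next
    fix c :: "'a \<Rightarrow> real" assume c: "\<And>i. 0 \<le> c i \<and> c i \<le> 1"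
    have "\<exists>a. (\<forall>k. a k \<in> {0, 1}) \<and> (\<lambda>k. (1/2) ^ Suc k * a k) sums c i" for i
      using binary_expansion[of "c i"] c[of i] by metis
    then obtain a :: "'a \<Rightarrow> nat \<Rightarrow> real" where a: "\<And>i k. a i k \<in> {0, 1}"
        "\<And>i. (\<lambda>k. (1/2) ^ Suc k * a i k) sums c i"
      by metis
    define b where "b j = a (inv_into Basis r (j mod DIM('a))) (j div DIM('a))" for j
    obtain t where t: "0 \<le> t" "t \<le> 1" "\<And>m. plateau (3 ^ m * t) = b m"
      using plateau_digits[of b] a(1) unfolding b_def by metis
    have "g i t = c i" if "i \<in> Basis" for i
    proof -
      have "r i < DIM('a)" "inv_into Basis r (r i) = i"
        using r that by (auto simp: bij_betw_def)
      then have "b (DIM('a) * k + r i) = a i k" for k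
        by (simp add: b_def)
      then show ?thesis
        using sums_unique[OF a(2)[of i]] by (simp add: g_def t(3))
    qed
    with t(1,2) show "\<exists>t\<in>{0..1}. \<forall>i\<in>Basis. g i t = c i" by (intro bexI[of _ t]) auto
  qed
qed

text \<open>On [2n, 2n+1] the periodic cube curve, scaled by \<open>s\<close> = n, sweeps the cube
  [-n, n]^d. An integer n between |p| and |p| + 2 reaches \<open>p\<close> at a time at most 1 + 2n,
  whence the constant 5. The linear bound on \<open>h\<close> is what later yields
  tightness.\<close>

lemma space_filling_curve:
  obtains G :: "real \<Rightarrow> 'a::euclidean_space" and h where
    "continuous_on UNIV G" "\<And>p. G (h p) = p" "\<And>p. \<bar>h p\<bar> \<le> 2 * norm p + 5"
proof -
  obtain g :: "'a \<Rightarrow> real \<Rightarrow> real" where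
    g_cont: "\<And>i. continuous_on UNIV (g i)" and g_per: "\<And>i t n. g i (t + 2 * real n) = g i t"
    and g_surj: "\<And>c. (\<And>i. 0 \<le> c i \<and> c i \<le> 1) \<Longrightarrow> \<exists>t\<in>{0..1}. \<forall>i\<in>Basis. g i t = c i"
    using cube_filling_curve by blast
  \<comment> \<open>\<open>s\<close> is continuous, constant on \<open>[2n, 2n+1]\<close> with value \<open>n\<close>, and affine in between.\<close>
  define s where "s t = t / 2 - arccos (cos (pi * t)) / (2 * pi)" for t
  define G where "G t = s t *\<^sub>R (\<Sum>i\<in>Basis. (2 * g i t - 1) *\<^sub>R i)" for t
  have "continuous_on UNIV s"
    unfolding s_def by (intro continuous_intros continuous_on_arccos) auto
  then have "continuous_on UNIV G"
    unfolding G_def by (intro continuous_intros g_cont)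
  moreover have "\<exists>t. G t = p \<and> \<bar>t\<bar> \<le> 2 * norm p + 5" for p
  proof -
    define n where "n = nat \<lceil>norm p\<rceil> + 1"
    have n: "norm p \<le> real n" "real n \<le> norm p + 2" "0 < n"
      unfolding n_def using norm_ge_zero[of p] by linarith+
    \<comment> \<open>Coordinates of \<open>p\<close> rescaled from [-n, n] to [0, 1]; the 0 off
      \<open>Basis\<close> is a filler that keeps every index within the bounds.\<close>
    define c where "c i = (if i \<in> Basis then (p \<bullet> i / n + 1) / 2 else 0)" for i
    have c01: "0 \<le> c i \<and> c i \<le> 1" for i
      using Basis_le_norm[of i p] n by (auto simp: c_def field_simps abs_le_iff)
    obtain t where t: "t \<in> {0..1}" "\<And>i. i \<in> Basis \<Longrightarrow> g i t = c i"
      using g_surj[of c] c01 by blast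
    have "s (t + 2 * real n) = real n"
      using t(1) by (simp add: s_def cos_shift_even arccos_cos mult_left_le add_divide_distrib)
    moreover have "real n * (2 * c i - 1) = p \<bullet> i" if "i \<in> Basis" for i
      using n(3) that by (simp add: c_def field_simps)
    ultimately have "G (t + 2 * real n) = (\<Sum>i\<in>Basis. (p \<bullet> i) *\<^sub>R i)"
      by (auto simp: G_def g_per t(2) scaleR_sum_right intro!: sum.cong)
    then have "G (t + 2 * real n) = p"
      by (simp add: euclidean_representation)
    moreover have "\<bar>t + 2 * real n\<bar> \<le> 2 * norm p + 5"
      using t(1) n(2) by simp
    ultimately show ?thesis by blast
  qed
  then obtain h where "\<And>p. G (h p) = p \<and> \<bar>h p\<bar> \<le> 2 * norm p + 5"
    by metis
  ultimately show ?thesis using that by blast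
qed

section \<open>Representation of positive functionals\<close>

text \<open>The growth rate of \<open>cost\<close>: on triples, a multiple of \<open>cost\<close>
  plus functions of \<open>x\<close> and of \<open>y\<close> dominates every such function. Being a
  pure size condition, it admits compositions with discontinuous maps.\<close>

definition quadratic_growth :: "('a::real_normed_vector \<Rightarrow> real) \<Rightarrow> bool" where
  "quadratic_growth f \<longleftrightarrow> (\<exists>C. \<forall>x. \<bar>f x\<bar> \<le> C * (1 + (norm x)\<^sup>2))"

lemma quadratic_growthI: "(\<And>x. \<bar>f x\<bar> \<le> C * (1 + (norm x)\<^sup>2)) \<Longrightarrow> quadratic_growth f"
  by (auto simp: quadratic_growth_def)

lemma quadratic_growth_bounded:
  fixes f :: "'a::real_normed_vector \<Rightarrow> real"
  assumes "\<And>x. \<bar>f x\<bar> \<le> B"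
  shows "quadratic_growth f"
proof (rule quadratic_growthI)
  fix x :: 'a
  have "B * 1 \<le> B * (1 + (norm x)\<^sup>2)"
    using order_trans[OF abs_ge_zero assms[of x]] by (intro mult_left_mono) auto
  then show "\<bar>f x\<bar> \<le> B * (1 + (norm x)\<^sup>2)"
    using assms[of x] by simp
qed

lemma quadratic_growth_add:
  assumes "quadratic_growth f" "quadratic_growth g"
  shows "quadratic_growth (\<lambda>x. f x + g x)"
proof -
  obtain C D where "\<And>x. \<bar>f x\<bar> \<le> C * (1 + (norm x)\<^sup>2)" "\<And>x. \<bar>g x\<bar> \<le> D * (1 + (norm x)\<^sup>2)"
    using assms unfolding quadratic_growth_def by blast
  then have "\<bar>f x + g x\<bar> \<le> (C + D) * (1 + (norm x)\<^sup>2)" for x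
    unfolding distrib_right by (meson abs_triangle_ineq add_mono order_trans)
  then show ?thesis by (rule quadratic_growthI)
qed

lemma quadratic_growth_mult_left:
  assumes "quadratic_growth f"
  shows "quadratic_growth (\<lambda>x. c * f x)"
proof -
  obtain C where "\<And>x. \<bar>f x\<bar> \<le> C * (1 + (norm x)\<^sup>2)"
    using assms unfolding quadratic_growth_def by blast
  then have "\<bar>c * f x\<bar> \<le> (\<bar>c\<bar> * C) * (1 + (norm x)\<^sup>2)" for x
    unfolding abs_mult mult.assoc by (intro mult_left_mono) auto
  then show ?thesis by (rule quadratic_growthI)
qed

lemma quadratic_growth_mono:
  assumes "quadratic_growth g" "\<And>x. \<bar>f x\<bar> \<le> \<bar>g x\<bar>"
  shows "quadratic_growth f"
  using assms unfolding quadratic_growth_def by (meson order_trans)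

lemma less_sqrt_plus_one_square:
  fixes x :: real
  assumes "0 \<le> x"
  shows "x < (sqrt x + 1)\<^sup>2"
proof -
  have "0 < 2 * sqrt x + 1"
    using assms by (intro add_nonneg_pos) auto
  then show ?thesis
    using real_sqrt_pow2[OF assms] by (simp add: power2_sum)
qed

locale positive_functional =
  fixes L :: "('a::euclidean_space \<Rightarrow> real) \<Rightarrow> real"
  assumes add: "quadratic_growth f \<Longrightarrow> quadratic_growth g \<Longrightarrow> L (\<lambda>x. f x + g x) = L f + L g"
    and scale: "quadratic_growth f \<Longrightarrow> L (\<lambda>x. c * f x) = c * L f"
    and mono: "quadratic_growth f \<Longrightarrow> quadratic_growth g \<Longrightarrow> (\<And>x. f x \<le> g x) \<Longrightarrow> L f \<le> L g"
    and unit: "L (\<lambda>_. 1) = 1"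
begin

lemma const: "L (\<lambda>_. c) = c"
  using scale[OF quadratic_growth_bounded[of "\<lambda>_. 1" 1], of c] unit by simp

lemma zero_le: "quadratic_growth f \<Longrightarrow> (\<And>x. 0 \<le> f x) \<Longrightarrow> 0 \<le> L f"
  using mono[of "\<lambda>_. 0" f] quadratic_growth_bounded[of "\<lambda>_. 0" 0] const[of 0] by simp

lemma sum:
  assumes "finite I" "\<And>i. i \<in> I \<Longrightarrow> quadratic_growth (f i)"
  shows "L (\<lambda>x. \<Sum>i\<in>I. f i x) = (\<Sum>i\<in>I. L (f i)) \<and> quadratic_growth (\<lambda>x. \<Sum>i\<in>I. f i x)"
  using assms
  by (induction I rule: finite_induct)
    (auto simp: const add intro: quadratic_growth_add quadratic_growth_bounded[of "\<lambda>_. 0" 0])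

lemma abs_diff_le:
  assumes fg: "quadratic_growth f" "quadratic_growth g" and q: "quadratic_growth q"
    and le: "\<And>x. \<bar>f x - g x\<bar> \<le> q x"
  shows "\<bar>L f - L g\<bar> \<le> L q"
proof -
  have 1: "L f \<le> L (\<lambda>x. g x + q x)"
    using fg q le by (intro mono quadratic_growth_add) (auto simp: abs_le_iff algebra_simps)
  have 2: "L g \<le> L (\<lambda>x. f x + q x)"
    using fg q le by (intro mono quadratic_growth_add) (auto simp: abs_le_iff algebra_simps)
  show ?thesis
    using 1 2 fg q by (simp add: add)
qed

text \<open>Only finitely many level sets of \<open>r\<close> occur, so finite additivity suffices:
  the values of \<open>L\<close> on their indicators are the weights of a probability mass
  function.\<close>

lemma finite_range_measure:
  fixes r :: "'a \<Rightarrow> real"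
  assumes "finite (range r)"
  obtains D where "real_distribution D" "\<And>\<phi>. \<phi> \<in> borel_measurable borel \<Longrightarrow> (\<integral>t. \<phi> t \<partial>D) = L (\<lambda>x. \<phi> (r x))"
proof -
  define w where "w s = L (\<lambda>x. of_bool (r x = s))" for s
  have ind: "quadratic_growth (\<lambda>x. of_bool (P x))" for P :: "'a \<Rightarrow> bool"
    by (rule quadratic_growth_bounded[of _ 1]) auto
  have expand: "L (\<lambda>x. \<phi> (r x)) = (\<Sum>s\<in>range r. \<phi> s * w s)" for \<phi>
  proof -
    have "(\<lambda>x. \<phi> (r x)) = (\<lambda>x. \<Sum>s\<in>range r. \<phi> s * of_bool (r x = s))"
      using assms by (auto simp: of_bool_def sum.delta if_distrib[of "(*) _"] cong: if_cong)
    then show ?thesis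
      using sum[OF assms, of "\<lambda>s x. \<phi> s * of_bool (r x = s)"]
      by (simp add: quadratic_growth_mult_left ind scale w_def)
  qed
  have w0: "0 \<le> w s" for s
    unfolding w_def by (intro zero_le ind) auto
  have w_out: "w s = 0" if "s \<notin> range r" for s
  proof -
    have "(\<lambda>x. of_bool (r x = s) :: real) = (\<lambda>_. 0)"
      using that by (auto simp: fun_eq_iff)
    then show ?thesis by (simp add: w_def const)
  qed
  have "(\<Sum>s\<in>range r. w s) = 1"
    using expand[of "\<lambda>_. 1"] unit by simp
  moreover have "(\<integral>\<^sup>+ s. ennreal (w s) \<partial>count_space UNIV) = (\<Sum>s\<in>range r. ennreal (w s))"
  proof (rule nn_integral_count_space')
    show "ennreal (w s) = 0" if "s \<notin> range r" for s
      using w_out[OF that] by simp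
  qed (use assms in auto)
  ultimately have one: "(\<integral>\<^sup>+ s. ennreal (w s) \<partial>count_space UNIV) = 1"
    using w0 by (simp add: sum_ennreal)
  define p where "p = embed_pmf w"
  have pmf: "pmf p s = w s" for s
    unfolding p_def using w0 one by (rule pmf_embed_pmf)
  have "set_pmf p \<subseteq> range r"
    using w_out pmf by (metis set_pmf_iff subsetI)
  then have int: "(\<integral>t. \<phi> t \<partial>measure_pmf p) = (\<Sum>s\<in>range r. \<phi> s * w s)" for \<phi> :: "real \<Rightarrow> real"
    using assms by (subst integral_measure_pmf[of "range r"]) (auto simp: pmf mult.commute)
  show ?thesis
  proof (rule that[of "distr (measure_pmf p) borel (\<lambda>t. t)"])
    show "real_distribution (distr (measure_pmf p) borel (\<lambda>t. t))"
      by (intro prob_space.real_distribution_distr prob_space_measure_pmf) simp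
    show "(\<integral>t. \<phi> t \<partial>distr (measure_pmf p) borel (\<lambda>t. t)) = L (\<lambda>x. \<phi> (r x))"
      if "\<phi> \<in> borel_measurable borel" for \<phi>
      using that by (subst integral_distr) (auto simp: int expand)
  qed
qed

text \<open>The functional is transported to the line along a right inverse \<open>h\<close> of a space-filling
  curve \<open>G\<close>; no regularity of \<open>h\<close> is needed because \<open>L\<close> is defined on all functions.\<close>

theorem representation:
  obtains M :: "'a measure" where "prob_space M" "sets M = sets borel"
    "\<And>f B. continuous_on UNIV f \<Longrightarrow> (\<And>x. \<bar>f x\<bar> \<le> B) \<Longrightarrow> (\<integral>x. f x \<partial>M) = L f"
proof -
  obtain G :: "real \<Rightarrow> 'a" and h where G: "continuous_on UNIV G" "\<And>p. G (h p) = p"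
    and h: "\<And>p. \<bar>h p\<bar> \<le> 2 * norm p + 5"
    using space_filling_curve by blast
  \<comment> \<open>Dominates the square of \<open>h\<close>, so \<open>L q\<close> is a
    second-moment bound and Chebyshev's inequality controls the set where |h| > K by L q /
    K^2.\<close>
  define q where "q p = (2 * norm p + 5)\<^sup>2" for p :: 'a
  have q: "quadratic_growth q"
  proof (rule quadratic_growthI)
    fix x :: 'a
    have "0 \<le> (2 * norm x - 5)\<^sup>2" by simp
    also have "\<dots> = 4 * (norm x)\<^sup>2 - 20 * norm x + 25"
      by (simp add: power2_eq_square algebra_simps)
    finally have 1: "20 * norm x \<le> 4 * (norm x)\<^sup>2 + 25" by simp
    have 2: "\<bar>q x\<bar> = 4 * (norm x)\<^sup>2 + 20 * norm x + 25"
      unfolding q_def abs_power2 by (simp add: power2_eq_square algebra_simps)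
    have "0 \<le> (norm x)\<^sup>2" by (rule zero_le_power2)
    with 1 show "\<bar>q x\<bar> \<le> 50 * (1 + (norm x)\<^sup>2)"
      unfolding 2 distrib_left by linarith
  qed
  have q_ge: "1 \<le> q p / K\<^sup>2" if "\<bar>h p\<bar> > K" "K > 0" for p K
  proof -
    have "K\<^sup>2 \<le> q p"
      unfolding q_def using h[of p] that by (intro power_mono) auto
    then show ?thesis using that by simp
  qed
  have q0: "0 \<le> q p" for p by (simp add: q_def)
  have Lq: "0 \<le> L q" by (intro zero_le q q0)
  \<comment> \<open>Rounding down to a grid of mesh 1/(n+1) inside a window of radius n+1, and 0
    outside: the range is finite, and every fixed \<open>t\<close> is eventually
    approximated.\<close>
  define r where "r n t = (if \<bar>t\<bar> \<le> real (Suc n) then of_int \<lfloor>real (Suc n) * t\<rfloor> / real (Suc n) else 0)" for n t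
  have r_near: "\<bar>r n t - t\<bar> \<le> 1 / real (Suc n)" if "\<bar>t\<bar> \<le> real (Suc n)" for n t
  proof -
    have "r n t - t = - (frac (real (Suc n) * t)) / real (Suc n)"
      using that by (simp add: r_def frac_def field_simps)
    then show ?thesis
      using frac_lt_1[of "real (Suc n) * t"] frac_ge_0[of "real (Suc n) * t"]
      by (simp add: divide_right_mono)
  qed
  have r_le: "\<bar>r n t\<bar> \<le> \<bar>t\<bar> + 1" for n t
  proof (cases "\<bar>t\<bar> \<le> real (Suc n)")
    case True
    have "1 / real (Suc n) \<le> 1" by simp
    then show ?thesis using r_near[OF True] by linarith
  qed (simp add: r_def)
  have fin: "finite (range (\<lambda>p. r n (h p)))" for n
  proof (rule finite_subset)
    show "range (\<lambda>p. r n (h p)) \<subseteq> insert 0 ((\<lambda>k::int. of_int k / real (Suc n)) ` {- (int (Suc n))\<^sup>2 - 1..(int (Suc n))\<^sup>2})"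
    proof clarify
      fix p assume 0: "r n (h p) \<notin> (\<lambda>k::int. of_int k / real (Suc n)) ` {- (int (Suc n))\<^sup>2 - 1..(int (Suc n))\<^sup>2}"
      show "r n (h p) = 0"
      proof (rule ccontr)
        assume "r n (h p) \<noteq> 0"
        then have a: "\<bar>h p\<bar> \<le> real (Suc n)" by (auto simp: r_def split: if_splits)
        have "\<bar>real (Suc n) * h p\<bar> \<le> real (Suc n) * real (Suc n)"
          unfolding abs_mult using a by (intro mult_mono) auto
        then have "\<bar>real (Suc n) * h p\<bar> \<le> real_of_int ((int (Suc n))\<^sup>2)"
          by (simp add: power2_eq_square)
        then have "\<lfloor>real (Suc n) * h p\<rfloor> \<in> {- (int (Suc n))\<^sup>2 - 1..(int (Suc n))\<^sup>2}"
          by (simp add: abs_le_iff del: of_nat_Suc of_int_power) linarith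
        with 0 a show False by (auto simp: r_def)
      qed
    qed
  qed simp
  have "\<exists>D. real_distribution D \<and> (\<forall>\<phi>\<in>borel_measurable borel. (\<integral>t. \<phi> t \<partial>D) = L (\<lambda>x. \<phi> (r n (h x))))" for n
    using finite_range_measure[OF fin[of n]] by metis
  then obtain D where D: "\<And>n. real_distribution (D n)"
    and D_int: "\<And>n \<phi>. \<phi> \<in> borel_measurable borel \<Longrightarrow> (\<integral>t. \<phi> t \<partial>D n) = L (\<lambda>x. \<phi> (r n (h x)))"
    by metis
  have "tight D"
    unfolding tight_def
  proof (intro conjI allI impI D)
    fix \<epsilon> :: real assume "\<epsilon> > 0"
    \<comment> \<open>The added 1 keeps \<open>K\<close> positive and makes L q / K^2 < \<epsilon>
      strict even when \<open>L q\<close> is 0. The interval below uses K + 2 because rounding may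
      move a point by 1 and its left end is open.\<close>
    define K where "K = sqrt (L q / \<epsilon>) + 1"
    have "K > 0" using Lq \<open>\<epsilon> > 0\<close> by (simp add: K_def add_nonneg_pos)
    have "L q / \<epsilon> < K\<^sup>2"
      unfolding K_def using Lq \<open>\<epsilon> > 0\<close> by (intro less_sqrt_plus_one_square) simp
    then have small: "L q / K\<^sup>2 < \<epsilon>"
      using \<open>\<epsilon> > 0\<close> \<open>K > 0\<close> by (simp add: field_simps)
    have "1 - \<epsilon> < measure (D n) {- (K + 2)<..K + 2}" for n
    proof -
      interpret real_distribution "D n" by (rule D)
      have "measure (D n) {- (K + 2)<..K + 2} = (\<integral>t. indicator {- (K + 2)<..K + 2} t \<partial>D n)"
        by simp
      also have "\<dots> = L (\<lambda>x. indicator {- (K + 2)<..K + 2} (r n (h x)))"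
        by (rule D_int) simp
      finally have eq: "measure (D n) {- (K + 2)<..K + 2} = \<dots>" .
      have "\<bar>L (\<lambda>_. 1) - L (\<lambda>x. indicator {- (K + 2)<..K + 2} (r n (h x)))\<bar> \<le> L (\<lambda>x. (1 / K\<^sup>2) * q x)"
      proof (rule abs_diff_le)
        show "\<bar>1 - indicator {- (K + 2)<..K + 2} (r n (h x))\<bar> \<le> (1 / K\<^sup>2) * q x" for x
          using q_ge[of K x] \<open>K > 0\<close> q0[of x] r_le[of n "h x"]
          by (cases "\<bar>h x\<bar> > K") (auto simp: indicator_def)
        show "quadratic_growth (\<lambda>x. (1 / K\<^sup>2) * q x)"
          by (intro quadratic_growth_mult_left q)
      qed (auto intro: quadratic_growth_bounded[of _ 1] simp: indicator_def)
      then show ?thesis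
        using small unit unfolding eq scale[OF q] abs_le_iff by simp
    qed
    then show "\<exists>a b. a < b \<and> (\<forall>n. 1 - \<epsilon> < measure (D n) {a<..b})"
      using \<open>K > 0\<close> by (intro exI[of _ "- (K + 2)"] exI[of _ "K + 2"]) auto
  qed
  then obtain s M0 where s: "strict_mono (s :: nat \<Rightarrow> nat)" and M0: "real_distribution M0" "weak_conv_m (D \<circ> id \<circ> s) M0"
    using tight_imp_convergent_subsubsequence[OF _ strict_mono_id] by blast
  interpret M0: real_distribution M0 by fact
  \<comment> \<open>Where |h| > K the difference is at most 2B, and Chebyshev makes the contribution
    less than e/2; elsewhere rounding and uniform continuity of \<open>\<phi>\<close> on
    [-(K+1), K+1] give at most e/2.\<close>
  have conv: "(\<lambda>n. L (\<lambda>x. \<phi> (r n (h x)))) \<longlonglongrightarrow> L (\<lambda>x. \<phi> (h x))"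
    if \<phi>: "continuous_on UNIV \<phi>" "\<And>t. \<bar>\<phi> t\<bar> \<le> B" for \<phi> :: "real \<Rightarrow> real" and B
  proof (rule LIMSEQ_I)
    fix e :: real assume "e > 0"
    have "B \<ge> 0" using \<phi>(2)[of 0] by linarith
    define K where "K = sqrt (4 * B * L q / e) + 1"
    have nn: "0 \<le> 4 * B * L q / e"
      using Lq \<open>e > 0\<close> \<open>B \<ge> 0\<close> by simp
    then have "K > 0" by (simp add: K_def add_nonneg_pos)
    have "4 * B * L q / e < K\<^sup>2"
      unfolding K_def using nn by (rule less_sqrt_plus_one_square)
    then have small: "(2 * B / K\<^sup>2) * L q < e / 2"
      using \<open>e > 0\<close> \<open>K > 0\<close> by (simp add: field_simps)
    have "uniformly_continuous_on {- (K + 1)..K + 1} \<phi>"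
      using \<phi>(1) by (intro compact_uniformly_continuous) (auto intro: continuous_on_subset)
    then obtain d where d: "d > 0"
      "\<And>x y. x \<in> {- (K + 1)..K + 1} \<Longrightarrow> y \<in> {- (K + 1)..K + 1} \<Longrightarrow> \<bar>y - x\<bar> < d \<Longrightarrow> \<bar>\<phi> y - \<phi> x\<bar> < e / 2"
      unfolding uniformly_continuous_on_def dist_real_def using \<open>e > 0\<close> by (metis half_gt_zero)
    obtain N where N: "1 / real (Suc N) < d" "K \<le> real (Suc N)"
    proof -
      obtain N1 where "inverse (real (Suc N1)) < d" using reals_Archimedean[OF d(1)] by blast
      moreover obtain N2 where "K \<le> real N2" using real_arch_simple by blast
      moreover have "1 / real (Suc (max N1 N2)) \<le> 1 / real (Suc N1)"
        by (intro divide_left_mono) auto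
      ultimately show ?thesis
        by (intro that[of "max N1 N2"]) (auto simp: inverse_eq_divide)
    qed
    have "norm (L (\<lambda>x. \<phi> (r n (h x))) - L (\<lambda>x. \<phi> (h x))) < e" if "n \<ge> N" for n
    proof -
      have "\<bar>L (\<lambda>x. \<phi> (r n (h x))) - L (\<lambda>x. \<phi> (h x))\<bar> \<le> L (\<lambda>x. e / 2 + (2 * B / K\<^sup>2) * q x)"
      proof (rule abs_diff_le)
        fix x
        have nonneg: "0 \<le> (2 * B / K\<^sup>2) * q x"
          using \<open>B \<ge> 0\<close> q0 by simp
        show "\<bar>\<phi> (r n (h x)) - \<phi> (h x)\<bar> \<le> e / 2 + (2 * B / K\<^sup>2) * q x"
        proof (cases "\<bar>h x\<bar> > K")
          case True
          have "\<bar>\<phi> (r n (h x)) - \<phi> (h x)\<bar> \<le> 2 * B * 1"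
            using \<phi>(2)[of "r n (h x)"] \<phi>(2)[of "h x"] by linarith
          also have "\<dots> \<le> 2 * B * (q x / K\<^sup>2)"
            using q_ge[OF True \<open>K > 0\<close>] \<open>B \<ge> 0\<close> by (intro mult_left_mono) auto
          finally show ?thesis using \<open>e > 0\<close> by simp
        next
          case False
          have "1 / real (Suc n) \<le> 1 / real (Suc N)"
            using that by (intro divide_left_mono) auto
          moreover have "\<bar>h x\<bar> \<le> real (Suc n)"
            using False N(2) that by simp
          ultimately have "\<bar>r n (h x) - h x\<bar> < d"
            using r_near[of "h x" n] N(1) by linarith
          moreover have "r n (h x) \<in> {- (K + 1)..K + 1}"
            using r_le[of n "h x"] False by (simp add: abs_le_iff)
          moreover have "h x \<in> {- (K + 1)..K + 1}"
            using False by auto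
          ultimately have "\<bar>\<phi> (r n (h x)) - \<phi> (h x)\<bar> < e / 2"
            by (intro d(2))
          then show ?thesis using nonneg by linarith
        qed
        show "quadratic_growth (\<lambda>x. e / 2 + (2 * B / K\<^sup>2) * q x)"
          by (intro quadratic_growth_add quadratic_growth_mult_left q
              quadratic_growth_bounded[of _ "\<bar>e / 2\<bar>"]) simp
      qed (rule quadratic_growth_bounded[OF \<phi>(2)])+
      also have "\<dots> = e / 2 + (2 * B / K\<^sup>2) * L q"
        by (subst add) (simp_all only: const scale[OF q] quadratic_growth_mult_left[OF q]
            quadratic_growth_bounded[of "\<lambda>_. e / 2", OF order_refl])
      finally show ?thesis using small by simp
    qed
    then show "\<exists>N. \<forall>n\<ge>N. norm (L (\<lambda>x. \<phi> (r n (h x))) - L (\<lambda>x. \<phi> (h x))) < e"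
      by blast
  qed
  have [measurable]: "G \<in> borel_measurable borel"
    using G(1) by (rule borel_measurable_continuous_onI)
  show ?thesis
  proof (rule that[of "distr M0 borel G"])
    show "prob_space (distr M0 borel G)"
      by (rule M0.prob_space_distr) simp
    fix f :: "'a \<Rightarrow> real" and B assume f: "continuous_on UNIV f" "\<And>x. \<bar>f x\<bar> \<le> B"
    have fG: "continuous_on UNIV (\<lambda>t. f (G t))"
      using continuous_on_compose2[OF f(1) G(1)] by simp
    have fG_meas: "(\<lambda>t. f (G t)) \<in> borel_measurable borel"
      using fG by (rule borel_measurable_continuous_onI)
    have "(\<lambda>n. \<integral>t. f (G t) \<partial>(D \<circ> id \<circ> s) n) \<longlonglongrightarrow> (\<integral>t. f (G t) \<partial>M0)"
      using fG f(2) D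
      by (intro weak_conv_imp_integral_bdd_continuous_conv[OF _ M0, where B=B])
        (auto simp: continuous_on_eq_continuous_at)
    then have 1: "(\<lambda>n. L (\<lambda>x. f (G (r (s n) (h x))))) \<longlonglongrightarrow> (\<integral>t. f (G t) \<partial>M0)"
      by (simp add: D_int[OF fG_meas])
    \<comment> \<open>The same sequence has a second limit, where the right inverse property G (h x)
      = x turns the functional on the line back into \<open>L f\<close>.\<close>
    have 2: "(\<lambda>n. L (\<lambda>x. f (G (r (s n) (h x))))) \<longlonglongrightarrow> L (\<lambda>x. f (G (h x)))"
      using LIMSEQ_subseq_LIMSEQ[OF conv[OF fG f(2)] s] by (simp add: comp_def)
    have "(\<integral>x. f x \<partial>distr M0 borel G) = (\<integral>t. f (G t) \<partial>M0)"
      using borel_measurable_continuous_onI[OF f(1)] by (subst integral_distr) auto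
    also have "\<dots> = L f"
      using LIMSEQ_unique[OF 1 2] by (simp add: G(2))
    finally show "(\<integral>x. f x \<partial>distr M0 borel G) = L f" .
  qed simp
qed

section \<open>From bounded to unbounded integrands\<close>

text \<open>Truncations at height \<open>n\<close> are represented exactly and stay below
  \<open>L f\<close> by positivity; monotone convergence does the rest. Equality may fail, as
  \<open>L\<close> can retain a contribution from infinity.\<close>

lemma representation_integrable_nonneg:
  assumes M: "prob_space M" "sets M = sets borel"
    and rep: "\<And>f B. continuous_on UNIV f \<Longrightarrow> (\<And>x. \<bar>f x\<bar> \<le> B) \<Longrightarrow> (\<integral>x. f x \<partial>M) = L f"
    and f: "continuous_on UNIV f" "quadratic_growth f" "\<And>x. 0 \<le> f x"
  shows "integrable M f" and "(\<integral>x. f x \<partial>M) \<le> L f"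
proof -
  interpret prob_space M by fact
  have meas: "borel_measurable M = (borel_measurable borel :: ('a \<Rightarrow> real) set)"
    using M(2) by (intro measurable_cong_sets) auto
  define g where "g n x = min (f x) (real n)" for n x
  have g_cont: "continuous_on UNIV (g n)" for n
    unfolding g_def by (intro continuous_intros f)
  have g_le: "\<bar>g n x\<bar> \<le> real n" for n x
    using f(3)[of x] by (simp add: g_def)
  have g_meas: "g n \<in> borel_measurable M" for n
    unfolding meas by (rule borel_measurable_continuous_onI[OF g_cont])
  have g_int: "integrable M (g n)" for n
    by (rule integrable_const_bound[of _ "real n"]) (use g_le g_meas in auto)
  have le: "(\<integral>x. g n x \<partial>M) \<le> L f" for n
  proof -
    have "(\<integral>x. g n x \<partial>M) = L (g n)"
      by (rule rep[OF g_cont g_le])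
    also have "\<dots> \<le> L f"
      by (intro mono f(2) quadratic_growth_bounded[OF g_le]) (simp add: g_def)
    finally show ?thesis .
  qed
  have inc: "incseq (\<lambda>n. \<integral>x. g n x \<partial>M)"
    unfolding mono_def by (auto intro!: integral_mono g_int simp: g_def)
  obtain l where l: "(\<lambda>n. \<integral>x. g n x \<partial>M) \<longlonglongrightarrow> l"
    using incseq_convergent[OF inc] le by blast
  have lim: "(\<lambda>n. g n x) \<longlonglongrightarrow> f x" for x
  proof (rule tendsto_eventually)
    obtain N where "f x \<le> real N" using real_arch_simple by blast
    then show "\<forall>\<^sub>F n in sequentially. g n x = f x"
      unfolding eventually_sequentially g_def
      by (intro exI[of _ N]) (auto simp: min_def)
  qed
  have f_meas: "f \<in> borel_measurable M"
    unfolding meas by (rule borel_measurable_continuous_onI[OF f(1)])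
  have "mono (\<lambda>n. g n x)" for x
    by (auto simp: mono_def g_def)
  then have "has_bochner_integral M f l"
    by (intro has_bochner_integral_monotone_convergence[where f=g] g_int AE_I2 lim l f_meas)
  then show "integrable M f" "(\<integral>x. f x \<partial>M) \<le> L f"
    using LIMSEQ_le_const2[OF l] le by (auto simp: has_bochner_integral_iff)
qed

text \<open>Truncation at height n+1 changes \<open>f\<close> by at most f^2/(n+1), and
  \<open>L\<close> is finite on f^2. So the truncations converge under \<open>L\<close> as well as
  under \<open>M\<close>, and no contribution from infinity survives.\<close>

lemma representation_subquadratic:
  assumes M: "prob_space M" "sets M = sets borel"
    and rep: "\<And>f B. continuous_on UNIV f \<Longrightarrow> (\<And>x. \<bar>f x\<bar> \<le> B) \<Longrightarrow> (\<integral>x. f x \<partial>M) = L f"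
    and f: "continuous_on UNIV f" "quadratic_growth (\<lambda>x. (f x)\<^sup>2)"
  shows "(\<integral>x. f x \<partial>M) = L f"
proof -
  interpret prob_space M by fact
  have meas: "borel_measurable M = (borel_measurable borel :: ('a \<Rightarrow> real) set)"
    using M(2) by (intro measurable_cong_sets) auto
  have f_le: "\<bar>f x\<bar> \<le> 1 + (f x)\<^sup>2" for x
    using norm_le_one_plus_square[of "f x"] by simp
  have qf: "quadratic_growth f"
  proof (rule quadratic_growth_mono)
    show "quadratic_growth (\<lambda>x. 1 + (f x)\<^sup>2)"
      by (intro quadratic_growth_add f(2) quadratic_growth_bounded[of _ 1]) simp
    show "\<bar>f x\<bar> \<le> \<bar>1 + (f x)\<^sup>2\<bar>" for x
      using f_le[of x] by simp
  qed
  have "integrable M (\<lambda>x. (f x)\<^sup>2)"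
    by (rule representation_integrable_nonneg(1)[OF M rep]) (auto intro!: continuous_intros f)
  then have bound: "integrable M (\<lambda>x. 1 + (f x)\<^sup>2)" by simp
  define g where "g n x = max (- real (Suc n)) (min (f x) (real (Suc n)))" for n x
  have g_cont: "continuous_on UNIV (g n)" for n
    unfolding g_def by (intro continuous_intros f)
  have g_le: "\<bar>g n x\<bar> \<le> real (Suc n)" for n x
    by (auto simp: g_def)
  have near: "\<bar>g n x - f x\<bar> \<le> (1 / real (Suc n)) * (f x)\<^sup>2" for n x
  proof (cases "\<bar>f x\<bar> \<le> real (Suc n)")
    case False
    then have "\<bar>g n x - f x\<bar> \<le> \<bar>f x\<bar>"
      unfolding g_def by linarith
    moreover have "real (Suc n) * \<bar>f x\<bar> \<le> \<bar>f x\<bar> * \<bar>f x\<bar>"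
      using False by (intro mult_right_mono) auto
    moreover have "real (Suc n) * \<bar>g n x - f x\<bar> \<le> real (Suc n) * \<bar>f x\<bar>"
      using calculation(1) by (intro mult_left_mono) auto
    ultimately have "real (Suc n) * \<bar>g n x - f x\<bar> \<le> (f x)\<^sup>2"
      unfolding power2_eq_square abs_mult_self_eq by linarith
    then show ?thesis
      by (simp add: pos_le_divide_eq mult.commute del: of_nat_Suc)
  qed (auto simp: g_def)
  have inv: "(\<lambda>n. 1 / real (Suc n) * c) \<longlonglongrightarrow> 0" for c
    by (rule tendsto_eq_intros LIMSEQ_Suc[OF lim_1_over_n] | simp)+
  have "(\<lambda>n. g n x) \<longlonglongrightarrow> f x" for x
  proof (rule LIM_zero_cancel[OF tendsto_rabs_zero_cancel])
    show "(\<lambda>n. \<bar>g n x - f x\<bar>) \<longlonglongrightarrow> 0"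
      by (rule tendsto_sandwich[OF _ _ tendsto_const inv[of "(f x)\<^sup>2"]])
        (simp_all only: always_eventually abs_ge_zero near simp_thms)
  qed
  then have "(\<lambda>n. \<integral>x. g n x \<partial>M) \<longlonglongrightarrow> (\<integral>x. f x \<partial>M)"
  proof (intro integral_dominated_convergence[OF _ _ bound] AE_I2)
    show "norm (g n x) \<le> 1 + (f x)\<^sup>2" for n x
      using f_le[of x] by (auto simp: g_def)
  qed (auto simp: meas intro!: borel_measurable_continuous_onI g_cont f)
  moreover have "(\<integral>x. g n x \<partial>M) = L (g n)" for n
    by (rule rep[OF g_cont g_le])
  moreover have "(\<lambda>n. L (g n)) \<longlonglongrightarrow> L f"
  proof (rule LIM_zero_cancel[OF tendsto_rabs_zero_cancel])
    have L_near: "\<bar>L (g n) - L f\<bar> \<le> 1 / real (Suc n) * L (\<lambda>x. (f x)\<^sup>2)" for n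
      using abs_diff_le[OF quadratic_growth_bounded[OF g_le] qf quadratic_growth_mult_left[OF f(2)] near]
      by (simp only: scale[OF f(2)])
    show "(\<lambda>n. \<bar>L (g n) - L f\<bar>) \<longlonglongrightarrow> 0"
      by (rule tendsto_sandwich[OF _ _ tendsto_const inv[of "L (\<lambda>x. (f x)\<^sup>2)"]])
        (simp_all only: always_eventually abs_ge_zero L_near simp_thms)
  qed
  ultimately show ?thesis
    using LIMSEQ_unique by simp
qed

end

section \<open>Weak duality\<close>

lemma norm_components_le:
  fixes w :: "'a::euclidean_space \<times> 'a \<times> 'a"
  shows "norm (fst w) \<le> norm w" "norm (fst (snd w)) \<le> norm w" "norm (snd (snd w)) \<le> norm w"
  using norm_fst_le[of "fst w" "snd w"] norm_snd_le[of "snd w" "fst w"]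
    norm_fst_le[of "fst (snd w)" "snd (snd w)"] norm_snd_le[of "snd (snd w)" "fst (snd w)"]
  by (simp_all add: order_trans)

lemma norm_triple_square:
  fixes x y z :: "'a::euclidean_space"
  shows "(norm (x, y, z))\<^sup>2 = (norm x)\<^sup>2 + (norm y)\<^sup>2 + (norm z)\<^sup>2"
  by (simp add: norm_Pair)

lemma norm_diff_square_le:
  fixes a b :: "'a::real_inner"
  shows "(norm (a - b))\<^sup>2 \<le> 2 * (norm a)\<^sup>2 + 2 * (norm b)\<^sup>2"
proof -
  have "0 \<le> (norm (a + b))\<^sup>2" by simp
  then show ?thesis
    unfolding power2_norm_eq_inner by (simp add: inner_simps inner_commute)
qed

lemma cost_nonneg: "0 \<le> cost x y z"
  by (simp add: cost_def)

lemma cost_le: "cost x y z \<le> 2 * (norm (x, y, z))\<^sup>2"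
  using norm_diff_square_le[of z x] norm_diff_square_le[of z y]
    zero_le_power2[of "norm x"] zero_le_power2[of "norm y"]
  unfolding norm_triple_square cost_def distrib_left add_divide_distrib by linarith

lemma continuous_on_cost: "continuous_on UNIV (\<lambda>(x, y, z). cost x y z)"
  unfolding cost_def case_prod_unfold by (intro continuous_intros) auto

lemma smooth_compact_support_bounded:
  fixes f :: "'a::euclidean_space \<Rightarrow> 'b::real_normed_vector"
  assumes "smooth f" "compact_support f"
  obtains B where "0 \<le> B" "\<And>x. norm (f x) \<le> B"
proof -
  have "continuous_on UNIV f"
    using assms(1) unfolding smooth_def by blast
  then have "compact (f ` closure {x. f x \<noteq> 0})"
    using assms(2) unfolding compact_support_def
    by (intro compact_continuous_image) (auto intro: continuous_on_subset)
  then obtain B where B: "\<And>y. y \<in> f ` closure {x. f x \<noteq> 0} \<Longrightarrow> norm y \<le> B"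
    using compact_imp_bounded bounded_iff by metis
  have "norm (f x) \<le> max 0 B" for x
    using B[of "f x"] closure_subset[of "{x. f x \<noteq> 0}"] by (cases "f x = 0") auto
  then show ?thesis using that[of "max 0 B"] by auto
qed

text \<open>Bumps times a basis vector are legitimate test maps, so each component of Z - X has zero
  conditional expectation given \<open>X\<close>. Measurable \<open>p\<close> of linear growth may
  then replace the test map; gradients of admissible functions are the intended case.\<close>

lemma martingale_test_extension:
  fixes \<pi> :: "'b::euclidean_space measure" and X Z :: "'b \<Rightarrow> 'a::euclidean_space"
  assumes \<pi>: "P2 \<pi>"
    and X: "continuous_on UNIV X" "\<And>w. norm (X w) \<le> norm w"
    and Z: "continuous_on UNIV Z" "\<And>w. norm (Z w) \<le> norm w"
    and test: "\<And>\<Phi> :: 'a \<Rightarrow> 'a. smooth \<Phi> \<Longrightarrow> compact_support \<Phi> \<Longrightarrow> (\<integral>w. (Z w - X w) \<bullet> \<Phi> (X w) \<partial>\<pi>) = 0"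
    and p: "p \<in> borel_measurable borel" "\<And>x. norm (p x) \<le> C * (1 + norm x)"
  shows "integrable \<pi> (\<lambda>w. (Z w - X w) \<bullet> p (X w))" and "(\<integral>w. (Z w - X w) \<bullet> p (X w) \<partial>\<pi>) = 0"
proof -
  have [measurable]: "X \<in> borel_measurable borel" "Z \<in> borel_measurable borel" "p \<in> borel_measurable borel"
    using X Z p by (auto intro: borel_measurable_continuous_onI)
  note meas = P2_measurable[OF \<pi>]
  have "C \<ge> 0"
    using order_trans[OF norm_ge_zero p(2)[of 0]] by simp
  have ZX: "norm (Z w - X w) \<le> 2 * norm w" for w
    using norm_triangle_ineq4[of "Z w" "X w"] X(2)[of w] Z(2)[of w] by linarith
  have pX: "norm (p (X w)) \<le> C * (1 + norm w)" for w
    using p(2)[of "X w"] mult_left_mono[OF X(2)[of w] \<open>C \<ge> 0\<close>] by (simp add: distrib_left)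
  have growth: "norm (Z w - X w) * norm (p (X w)) \<le> (4 * C) * (1 + (norm w)\<^sup>2)" for w
  proof -
    have "norm (Z w - X w) * norm (p (X w)) \<le> (2 * norm w) * (C * (1 + norm w))"
      by (intro mult_mono ZX pX) auto
    also have "\<dots> = C * (2 * (norm w + (norm w)\<^sup>2))"
      by (simp add: power2_eq_square algebra_simps)
    also have "\<dots> \<le> C * (4 * (1 + (norm w)\<^sup>2))"
      using norm_le_one_plus_square[of w] zero_le_power2[of "norm w"]
      by (intro mult_left_mono \<open>C \<ge> 0\<close>, unfold distrib_left) linarith
    finally show ?thesis by (simp only: mult.assoc mult.left_commute)
  qed
  have comp: "integrable \<pi> (\<lambda>w. ((Z w - X w) \<bullet> e) * (p (X w) \<bullet> e))" if "e \<in> Basis" for e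
  proof (rule P2_integrable_quadratic[OF \<pi>])
    show "norm (((Z w - X w) \<bullet> e) * (p (X w) \<bullet> e)) \<le> (4 * C) * (1 + (norm w)\<^sup>2)" for w
      using growth[of w] mult_mono[OF Basis_le_norm[OF that, of "Z w - X w"] Basis_le_norm[OF that, of "p (X w)"]]
      by (simp add: abs_mult)
  qed simp
  have zero: "(\<integral>w. ((Z w - X w) \<bullet> e) * (p (X w) \<bullet> e) \<partial>\<pi>) = 0" if "e \<in> Basis" for e
  proof (rule integral_weighted_eq_0[where X=X and k="\<lambda>w. (Z w - X w) \<bullet> e" and g="\<lambda>x. p x \<bullet> e"])
    show "X \<in> borel_measurable \<pi>" by (simp add: meas)
    show "integrable \<pi> (\<lambda>w. (Z w - X w) \<bullet> e)"
    proof (rule P2_integrable_quadratic[OF \<pi>])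
      show "norm ((Z w - X w) \<bullet> e) \<le> 2 * (1 + (norm w)\<^sup>2)" for w
        using Basis_le_norm[OF that, of "Z w - X w"] ZX[of w] norm_le_one_plus_square[of w] by simp
    qed simp
    show "(\<integral>w. ((Z w - X w) \<bullet> e) * box_bump n a b (X w) \<partial>\<pi>) = 0" for n a b
      using test[OF flat_algebra_smooth[OF box_bump_flat_algebra] box_bump_compact_support, of n a b e]
      by (simp add: mult.commute)
    show "(\<lambda>x. p x \<bullet> e) \<in> borel_measurable borel" by simp
  qed (rule comp[OF that])
  have eq: "(\<lambda>w. (Z w - X w) \<bullet> p (X w)) = (\<lambda>w. \<Sum>e\<in>Basis. ((Z w - X w) \<bullet> e) * (p (X w) \<bullet> e))"
    by (rule ext) (rule euclidean_inner)
  show "integrable \<pi> (\<lambda>w. (Z w - X w) \<bullet> p (X w))"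
    unfolding eq by (intro Bochner_Integration.integrable_sum comp)
  show "(\<integral>w. (Z w - X w) \<bullet> p (X w) \<partial>\<pi>) = 0"
    unfolding eq by (subst Bochner_Integration.integral_sum) (auto simp: comp zero)
qed

abbreviation (input) contact_gap :: "('a::euclidean_space \<Rightarrow> real) \<Rightarrow> 'a \<Rightarrow> 'a \<Rightarrow> 'a \<Rightarrow> real" where
  "contact_gap u x y z \<equiv> (u y + grad u y \<bullet> (z - y)) - (u x + grad u x \<bullet> (z - x))"

text \<open>\<open>u z\<close> lies above the lower parabola at \<open>y\<close> and below the upper
  parabola at \<open>x\<close>. Eliminating \<open>u z\<close> leaves the two errors, which are the
  two halves of \<open>cost\<close>.\<close>

lemma contact_gap_le_cost:
  assumes "adm u"
  shows "contact_gap u x y z \<le> cost x y z"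
  using adm_grad(1)[OF assms, of z y] adm_grad(1)[OF assms, of z x]
  unfolding cost_def add_divide_distrib abs_le_iff by linarith

text \<open>The marginals turn the two values of \<open>u\<close> into \<open>gain\<close>, and the
  martingale constraints, extended to the Lipschitz map \<open>grad u\<close>, annihilate the two
  gradient terms.\<close>

lemma Sigma_mart_integrals:
  fixes \<mu> \<nu> :: "'a::euclidean_space measure"
  assumes u: "adm u" and \<pi>: "\<pi> \<in> Sigma_mart \<mu> \<nu>" and P2: "P2 \<mu>" "P2 \<nu>"
  shows "integrable \<pi> (\<lambda>(x, y, z). contact_gap u x y z)"
    and "(\<integral>(x, y, z). contact_gap u x y z \<partial>\<pi>) = gain \<mu> \<nu> u"
    and "integrable \<pi> (\<lambda>(x, y, z). cost x y z)"
proof -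
  have \<pi>2: "P2 \<pi>" and \<mu>: "distr \<pi> borel fst = \<mu>" and \<nu>: "distr \<pi> borel (\<lambda>(x, y, z). y) = \<nu>"
    and t1: "\<And>\<Phi> :: 'a \<Rightarrow> 'a. smooth \<Phi> \<Longrightarrow> compact_support \<Phi> \<Longrightarrow> (\<integral>(x,y,z). (z - x) \<bullet> \<Phi> x \<partial>\<pi>) = 0"
    and t2: "\<And>\<Psi> :: 'a \<Rightarrow> 'a. smooth \<Psi> \<Longrightarrow> compact_support \<Psi> \<Longrightarrow> (\<integral>(x,y,z). (z - y) \<bullet> \<Psi> y \<partial>\<pi>) = 0"
    using \<pi> unfolding Sigma_mart_def by blast+
  note meas = P2_measurable[OF \<pi>2]
  have y_eq: "(\<lambda>(x, y, z). y) = (\<lambda>w :: 'a \<times> 'a \<times> 'a. fst (snd w))"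
    by (simp add: case_prod_unfold)
  have fst_meas: "fst \<in> borel_measurable \<pi>" "(\<lambda>w. fst (snd w)) \<in> borel_measurable \<pi>"
    unfolding meas by (auto intro!: borel_measurable_continuous_onI continuous_intros)
  have u_meas: "u \<in> borel_measurable borel"
    by (rule adm_measurable[OF u])
  have "integrable (distr \<pi> borel fst) u" "integrable (distr \<pi> borel (\<lambda>w. fst (snd w))) u"
    using adm_integrable[OF u] P2 \<mu> \<nu> y_eq by auto
  then have ux: "integrable \<pi> (\<lambda>w. u (fst w))" and uy: "integrable \<pi> (\<lambda>w. u (fst (snd w)))"
    using integrable_distr[OF fst_meas(1)] integrable_distr[OF fst_meas(2)] by auto
  have "(\<integral>w. u (fst w) \<partial>\<pi>) = (\<integral>x. u x \<partial>\<mu>)" "(\<integral>w. u (fst (snd w)) \<partial>\<pi>) = (\<integral>x. u x \<partial>\<nu>)"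
    using integral_distr[OF fst_meas(1) u_meas] integral_distr[OF fst_meas(2) u_meas] \<mu> \<nu> y_eq by auto
  note u_int = this
  have g_meas: "grad u \<in> borel_measurable borel"
  proof (rule borel_measurable_continuous_onI)
    have "1-lipschitz_on UNIV (grad u)"
      using adm_grad(2)[OF u] by (intro lipschitz_onI) (auto simp: dist_norm)
    then show "continuous_on UNIV (grad u)"
      by (rule lipschitz_on_continuous_on)
  qed
  have g_le: "norm (grad u x) \<le> (norm (grad u 0) + 1) * (1 + norm x)" for x
  proof -
    have "norm (grad u x) \<le> norm (grad u 0) + norm x"
      using adm_grad(2)[OF u, of x 0] norm_triangle_sub[of "grad u x" "grad u 0"] by simp
    also have "\<dots> \<le> (norm (grad u 0) + 1) * (1 + norm x)"
      by (simp add: algebra_simps)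
    finally show ?thesis .
  qed
  have gx: "integrable \<pi> (\<lambda>w. (snd (snd w) - fst w) \<bullet> grad u (fst w))"
    "(\<integral>w. (snd (snd w) - fst w) \<bullet> grad u (fst w) \<partial>\<pi>) = 0"
    using t1 by (intro martingale_test_extension[OF \<pi>2 _ _ _ _ _ g_meas g_le];
        auto intro!: continuous_intros norm_components_le simp: case_prod_unfold)+
  have gy: "integrable \<pi> (\<lambda>w. (snd (snd w) - fst (snd w)) \<bullet> grad u (fst (snd w)))"
    "(\<integral>w. (snd (snd w) - fst (snd w)) \<bullet> grad u (fst (snd w)) \<partial>\<pi>) = 0"
    using t2 by (intro martingale_test_extension[OF \<pi>2 _ _ _ _ _ g_meas g_le];
        auto intro!: continuous_intros norm_components_le simp: case_prod_unfold)+
  have eq: "(\<lambda>(x, y, z). contact_gap u x y z) = (\<lambda>w. (u (fst (snd w)) + (snd (snd w) - fst (snd w)) \<bullet> grad u (fst (snd w)))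
      - (u (fst w) + (snd (snd w) - fst w) \<bullet> grad u (fst w)))"
    by (simp add: case_prod_unfold inner_commute)
  show "integrable \<pi> (\<lambda>(x, y, z). contact_gap u x y z)"
    unfolding eq using ux uy gx(1) gy(1) by simp
  show "(\<integral>(x, y, z). contact_gap u x y z \<partial>\<pi>) = gain \<mu> \<nu> u"
    unfolding eq using ux uy gx gy u_int by (simp add: gain_def)
  show "integrable \<pi> (\<lambda>(x, y, z). cost x y z)"
  proof (rule P2_integrable_quadratic[OF \<pi>2])
    show "(\<lambda>(x, y, z). cost x y z) \<in> borel_measurable borel"
      by (rule borel_measurable_continuous_onI[OF continuous_on_cost])
    show "norm (case w of (x, y, z) \<Rightarrow> cost x y z) \<le> 2 * (1 + (norm w)\<^sup>2)" for w :: "'a \<times> 'a \<times> 'a"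
      using cost_le[of "fst w" "fst (snd w)" "snd (snd w)"] cost_nonneg[of "fst w" "fst (snd w)" "snd (snd w)"]
      by (simp add: case_prod_unfold)
  qed
qed

section \<open>Strong duality\<close>

lemma quadratic_growth_norm_square: "quadratic_growth (\<lambda>w. (norm w)\<^sup>2)"
  by (rule quadratic_growthI[of _ 1]) simp

lemma quadratic_growth_triple:
  fixes u :: "'a::euclidean_space \<Rightarrow> real"
  assumes "quadratic_growth u" and X: "\<And>w :: 'a \<times> 'a \<times> 'a. norm (X w) \<le> norm w"
  shows "quadratic_growth (\<lambda>w. u (X w))"
proof -
  obtain C where C: "\<And>x. \<bar>u x\<bar> \<le> C * (1 + (norm x)\<^sup>2)"
    using assms(1) unfolding quadratic_growth_def by blast
  have "0 \<le> C"
    using order_trans[OF abs_ge_zero C[of 0]] by simp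
  then have "C * (1 + (norm (X w))\<^sup>2) \<le> C * (1 + (norm w)\<^sup>2)" for w
    using X[of w] by (intro mult_left_mono add_left_mono power_mono) auto
  then show ?thesis
    using C order_trans by (intro quadratic_growthI[of _ C]) blast
qed

text \<open>Le Gruyer's interpolation makes the constraint of the relaxed dual problem, with
  independent \<open>u\<close>, \<open>v\<close>, \<open>p\<close>, \<open>q\<close>, equivalent to the original one.\<close>

lemma relaxed_dual_bound:
  fixes \<mu> \<nu> :: "'a::euclidean_space measure"
  assumes P2: "P2 \<mu>" "P2 \<nu>" and gain: "\<And>w. adm w \<Longrightarrow> gain \<mu> \<nu> w \<le> I"
    and int: "integrable \<mu> u" "integrable \<nu> v" and t: "0 \<le> t"
    and le: "\<And>x y z. 0 \<le> u x + v y + p x \<bullet> (z - x) + q y \<bullet> (z - y) + t * cost x y z"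
  shows "0 \<le> (\<integral>x. u x \<partial>\<mu>) + (\<integral>y. v y \<partial>\<nu>) + t * I"
proof -
  \<comment> \<open>With s > 0 the constraint can be divided by \<open>s\<close>; interpolation then
    places an admissible \<open>U\<close> between -v/s and u/s, and its gain is at most
    \<open>I\<close>.\<close>
  have pos: "0 \<le> (\<integral>x. u x \<partial>\<mu>) + (\<integral>y. v y \<partial>\<nu>) + s * I"
    if s: "0 < s" and le: "\<And>x y z. 0 \<le> u x + v y + p x \<bullet> (z - x) + q y \<bullet> (z - y) + s * cost x y z" for s
  proof -
    define i where "i = inverse s"
    have i: "0 < i" "i * s = 1"
      using s by (auto simp: i_def)
    have "- (i * v y) + (- (i *\<^sub>R q y)) \<bullet> (z - y) - (i * u x + (i *\<^sub>R p x) \<bullet> (z - x)) \<le> cost x y z" for x y z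
    proof -
      have "0 \<le> i * (u x + v y + p x \<bullet> (z - x) + q y \<bullet> (z - y) + s * cost x y z)"
        using i le by simp
      also have "\<dots> = i * u x + i * v y + i * (p x \<bullet> (z - x)) + i * (q y \<bullet> (z - y)) + (i * s) * cost x y z"
        by (simp add: algebra_simps)
      finally show ?thesis
        using i by simp
    qed
    then obtain U where U: "adm U" "\<And>x. - (i * v x) \<le> U x" "\<And>x. U x \<le> i * u x"
      using three_point_interpolation[of "\<lambda>x. - (i * v x)" "\<lambda>x. - (i *\<^sub>R q x)" "\<lambda>x. i * u x" "\<lambda>x. i *\<^sub>R p x"]
      by blast
    have "(\<integral>x. - (i * v x) \<partial>\<nu>) \<le> (\<integral>x. U x \<partial>\<nu>)" "(\<integral>x. U x \<partial>\<mu>) \<le> (\<integral>x. i * u x \<partial>\<mu>)"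
      using adm_integrable[OF U(1)] P2 int U(2,3)
      by (intro integral_mono Bochner_Integration.integrable_minus integrable_mult_right; simp)+
    then have "- (i * (\<integral>x. v x \<partial>\<nu>)) - i * (\<integral>x. u x \<partial>\<mu>) \<le> gain \<mu> \<nu> U"
      by (simp add: gain_def)
    also have "\<dots> \<le> I" by (rule gain[OF U(1)])
    finally have "s * (- (i * (\<integral>x. v x \<partial>\<nu>)) - i * (\<integral>x. u x \<partial>\<mu>)) \<le> s * I"
      using s by (intro mult_left_mono) auto
    also have "s * (- (i * (\<integral>x. v x \<partial>\<nu>)) - i * (\<integral>x. u x \<partial>\<mu>)) = - ((i * s) * ((\<integral>x. v x \<partial>\<nu>) + (\<integral>x. u x \<partial>\<mu>)))"
      by (simp add: algebra_simps)
    finally show ?thesis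
      using i by simp
  qed
  \<comment> \<open>The multiplier \<open>t\<close> may be 0. Any s > t keeps the constraint valid
    because \<open>cost\<close> is nonnegative, and the conclusion is continuous in
    \<open>s\<close>.\<close>
  have "0 \<le> (\<integral>x. u x \<partial>\<mu>) + (\<integral>y. v y \<partial>\<nu>) + s * I" if "t < s" for s
  proof (rule pos)
    show "0 < s" using t that by simp
    fix x y z :: 'a
    have "t * cost x y z \<le> s * cost x y z"
      using that by (intro mult_right_mono cost_nonneg) simp
    then show "0 \<le> u x + v y + p x \<bullet> (z - x) + q y \<bullet> (z - y) + s * cost x y z"
      using le[of x y z] by linarith
  qed
  then have "\<forall>\<^sub>F s in at_right t. 0 \<le> (\<integral>x. u x \<partial>\<mu>) + (\<integral>y. v y \<partial>\<nu>) + s * I"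
    by (auto simp: eventually_at_filter)
  moreover have "((\<lambda>s. (\<integral>x. u x \<partial>\<mu>) + (\<integral>y. v y \<partial>\<nu>) + s * I)
      \<longlongrightarrow> (\<integral>x. u x \<partial>\<mu>) + (\<integral>y. v y \<partial>\<nu>) + t * I) (at_right t)"
    by (intro tendsto_intros)
  ultimately show ?thesis
    by (intro tendsto_lowerbound) auto
qed

text \<open>\<open>E0\<close> prices functions from above: \<open>f\<close> is dominated by terms in
  \<open>u\<close> and \<open>v\<close>, priced by their integrals, by martingale terms, priced 0,
  and by a multiple of \<open>cost\<close>, priced \<open>I\<close> per unit. Consistency of these
  prices is \<open>relaxed_dual_bound\<close>. Terms available with both signs get their price
  exactly, \<open>cost\<close> only an upper bound.\<close>

lemma exists_positive_functional:
  fixes \<mu> \<nu> :: "'a::euclidean_space measure"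
  assumes P2: "P2 \<mu>" "P2 \<nu>" and gain: "\<And>w. adm w \<Longrightarrow> gain \<mu> \<nu> w \<le> I"
  obtains L :: "('a \<times> 'a \<times> 'a \<Rightarrow> real) \<Rightarrow> real" where
    "positive_functional L"
    "\<And>u. u \<in> borel_measurable borel \<Longrightarrow> quadratic_growth u \<Longrightarrow> L (\<lambda>w. u (fst w)) = (\<integral>x. u x \<partial>\<mu>)"
    "\<And>u. u \<in> borel_measurable borel \<Longrightarrow> quadratic_growth u \<Longrightarrow> L (\<lambda>w. u (fst (snd w))) = (\<integral>x. u x \<partial>\<nu>)"
    "\<And>p. quadratic_growth (\<lambda>(x, y :: 'a, z). (z - x) \<bullet> p x) \<Longrightarrow> L (\<lambda>(x, y, z). (z - x) \<bullet> p x) = 0"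
    "\<And>p. quadratic_growth (\<lambda>(x :: 'a, y, z). (z - y) \<bullet> p y) \<Longrightarrow> L (\<lambda>(x, y, z). (z - y) \<bullet> p y) = 0"
    "L (\<lambda>(x, y, z). cost x y z) \<le> I"
proof -
  define ok where "ok u \<longleftrightarrow> u \<in> borel_measurable borel \<and> quadratic_growth u" for u :: "'a \<Rightarrow> real"
  have ok_int: "integrable M u" if "ok u" "P2 M" for u and M :: "'a measure"
    using that unfolding ok_def quadratic_growth_def real_norm_def[symmetric]
    by (metis P2_integrable_quadratic)
  have ok_add: "ok (\<lambda>x. u x + v x)" if "ok u" "ok v" for u v
    using that by (auto simp: ok_def intro: quadratic_growth_add)
  have ok_mult: "ok (\<lambda>x. c * u x)" if "ok u" for u c
    using that by (auto simp: ok_def intro: quadratic_growth_mult_left)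
  have ok_const: "ok (\<lambda>_. c)" for c
    unfolding ok_def by (auto intro: quadratic_growth_bounded[of _ "\<bar>c\<bar>"])
  have ok_sq: "ok (\<lambda>x. (norm x)\<^sup>2)"
    unfolding ok_def by (simp add: quadratic_growth_norm_square)
  define E0 :: "(('a \<times> 'a \<times> 'a \<Rightarrow> real) \<times> real) set" where
    "E0 = {(f, (\<integral>x. u x \<partial>\<mu>) + (\<integral>y. v y \<partial>\<nu>) + t * I) | f u v p q t. ok u \<and> ok v \<and> 0 \<le> t \<and>
      (\<forall>x y z. f (x, y, z) \<le> u x + v y + p x \<bullet> (z - x) + q y \<bullet> (z - y) + t * cost x y z)}"
  have E0_I: "(f, r) \<in> E0"
    if "ok u" "ok v" "0 \<le> t" "r = (\<integral>x. u x \<partial>\<mu>) + (\<integral>y. v y \<partial>\<nu>) + t * I"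
      "\<And>x y z. f (x, y, z) \<le> u x + v y + p x \<bullet> (z - x) + q y \<bullet> (z - y) + t * cost x y z" for f r u v p q t
    unfolding E0_def using that by blast
  have E0_E: "\<exists>u v p q t. ok u \<and> ok v \<and> 0 \<le> t \<and> r = (\<integral>x. u x \<partial>\<mu>) + (\<integral>y. v y \<partial>\<nu>) + t * I \<and>
      (\<forall>x y z. f (x, y, z) \<le> u x + v y + p x \<bullet> (z - x) + q y \<bullet> (z - y) + t * cost x y z)"
    if "(f, r) \<in> E0" for f r
    using that unfolding E0_def by blast
  obtain L where L_le: "\<And>f r. quadratic_growth f \<Longrightarrow> (f, r) \<in> E0 \<Longrightarrow> L f \<le> r"
    and L_add: "\<And>f g. quadratic_growth f \<Longrightarrow> quadratic_growth g \<Longrightarrow> L (\<lambda>x. f x + g x) = L f + L g"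
    and L_scale: "\<And>f t. quadratic_growth f \<Longrightarrow> L (\<lambda>x. t * f x) = t * L f"
  proof (rule linear_selection_of_cone[of E0 "Collect quadratic_growth"])
    fix f r g s assume fr: "(f, r) \<in> E0" and gs: "(g, s) \<in> E0"
    obtain u v p q t where f: "ok u" "ok v" "0 \<le> t" "r = (\<integral>x. u x \<partial>\<mu>) + (\<integral>y. v y \<partial>\<nu>) + t * I"
      "\<And>x y z. f (x, y, z) \<le> u x + v y + p x \<bullet> (z - x) + q y \<bullet> (z - y) + t * cost x y z"
      using E0_E[OF fr] by blast
    obtain u' v' p' q' t' where g: "ok u'" "ok v'" "0 \<le> t'" "s = (\<integral>x. u' x \<partial>\<mu>) + (\<integral>y. v' y \<partial>\<nu>) + t' * I"
      "\<And>x y z. g (x, y, z) \<le> u' x + v' y + p' x \<bullet> (z - x) + q' y \<bullet> (z - y) + t' * cost x y z"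
      using E0_E[OF gs] by blast
    show "((\<lambda>w. f w + g w), r + s) \<in> E0"
    proof (rule E0_I)
      show "r + s = (\<integral>x. u x + u' x \<partial>\<mu>) + (\<integral>y. v y + v' y \<partial>\<nu>) + (t + t') * I"
        using f g P2 by (simp add: ok_int distrib_right)
      show "f (x, y, z) + g (x, y, z) \<le> (u x + u' x) + (v y + v' y) + (p x + p' x) \<bullet> (z - x)
          + (q y + q' y) \<bullet> (z - y) + (t + t') * cost x y z" for x y z
        using f(5)[of x y z] g(5)[of x y z] unfolding inner_add_left distrib_right by linarith
    qed (use f g in \<open>auto intro: ok_add\<close>)
  next
    fix f r and c :: real assume fr: "(f, r) \<in> E0" and c: "0 \<le> c"
    obtain u v p q t where f: "ok u" "ok v" "0 \<le> t" "r = (\<integral>x. u x \<partial>\<mu>) + (\<integral>y. v y \<partial>\<nu>) + t * I"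
      "\<And>x y z. f (x, y, z) \<le> u x + v y + p x \<bullet> (z - x) + q y \<bullet> (z - y) + t * cost x y z"
      using E0_E[OF fr] by blast
    show "((\<lambda>w. c * f w), c * r) \<in> E0"
    proof (rule E0_I)
      show "c * r = (\<integral>x. c * u x \<partial>\<mu>) + (\<integral>y. c * v y \<partial>\<nu>) + (c * t) * I"
        using f by (simp add: algebra_simps)
      show "c * f (x, y, z) \<le> c * u x + c * v y + (c *\<^sub>R p x) \<bullet> (z - x) + (c *\<^sub>R q y) \<bullet> (z - y) + (c * t) * cost x y z" for x y z
        using mult_left_mono[OF f(5)[of x y z] c] by (simp add: algebra_simps)
    qed (use f c in \<open>auto intro: ok_mult\<close>)
  next
    fix r assume "((\<lambda>_. 0), r) \<in> E0"
    then obtain u v p q t where f: "ok u" "ok v" "0 \<le> t" "r = (\<integral>x. u x \<partial>\<mu>) + (\<integral>y. v y \<partial>\<nu>) + t * I"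
      "\<And>x y z. 0 \<le> u x + v y + p x \<bullet> (z - x) + q y \<bullet> (z - y) + t * cost x y z"
      using E0_E by blast
    show "0 \<le> r"
      unfolding f(4) using f ok_int P2 by (intro relaxed_dual_bound[OF P2 gain]) auto
  next
    fix f :: "'a \<times> 'a \<times> 'a \<Rightarrow> real" assume "f \<in> Collect quadratic_growth"
    then obtain C where C: "\<And>w. \<bar>f w\<bar> \<le> C * (1 + (norm w)\<^sup>2)"
      unfolding quadratic_growth_def by blast
    have "0 \<le> C"
      using order_trans[OF abs_ge_zero C[of 0]] by (simp add: zero_prod_def)
    \<comment> \<open>The coefficients come from |z|^2 \<le> 2|z - x|^2 + 2|x|^2 and |z - x|^2 \<le>
      2 \<open>cost\<close>, so that |z|^2 is controlled without any constraint on the third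
      marginal.\<close>
    have "(f, (\<integral>x. C * (1 + 3 * (norm x)\<^sup>2) \<partial>\<mu>) + (\<integral>y. C * (norm y)\<^sup>2 \<partial>\<nu>) + (4 * C) * I) \<in> E0"
    proof (rule E0_I)
      fix x y z :: 'a
      have "(norm z)\<^sup>2 \<le> 2 * (norm (z - x))\<^sup>2 + 2 * (norm x)\<^sup>2"
        using norm_diff_square_le[of "z - x" "- x"] by simp
      moreover have "(norm (z - x))\<^sup>2 \<le> 2 * cost x y z"
        by (simp add: cost_def)
      ultimately have "1 + (norm (x, y, z))\<^sup>2 \<le> 1 + 3 * (norm x)\<^sup>2 + (norm y)\<^sup>2 + 4 * cost x y z"
        unfolding norm_triple_square by linarith
      then have "C * (1 + (norm (x, y, z))\<^sup>2) \<le> C * (1 + 3 * (norm x)\<^sup>2 + (norm y)\<^sup>2 + 4 * cost x y z)"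
        using \<open>0 \<le> C\<close> by (rule mult_left_mono)
      then show "f (x, y, z) \<le> C * (1 + 3 * (norm x)\<^sup>2) + C * (norm y)\<^sup>2 + 0 \<bullet> (z - x) + 0 \<bullet> (z - y) + (4 * C) * cost x y z"
        using C[of "(x, y, z)"] by (simp add: algebra_simps abs_le_iff)
    qed (use \<open>0 \<le> C\<close> in \<open>auto intro!: ok_mult ok_add ok_const ok_sq\<close>)
    then show "\<exists>r. (f, r) \<in> E0" by blast
  next
    show "(\<lambda>w. - f w) \<in> Collect quadratic_growth" if "f \<in> Collect quadratic_growth" for f :: "'a \<times> 'a \<times> 'a \<Rightarrow> real"
      using quadratic_growth_mult_left[of f "- 1"] that by simp
  next
    fix L' :: "('a \<times> 'a \<times> 'a \<Rightarrow> real) \<Rightarrow> real"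
    assume L': "\<And>f r. f \<in> Collect quadratic_growth \<Longrightarrow> (f, r) \<in> E0 \<Longrightarrow> L' f \<le> r"
      "\<And>f g. f \<in> Collect quadratic_growth \<Longrightarrow> g \<in> Collect quadratic_growth \<Longrightarrow>
        (\<lambda>x. f x + g x) \<in> Collect quadratic_growth \<Longrightarrow> L' (\<lambda>x. f x + g x) = L' f + L' g"
      "\<And>f t. f \<in> Collect quadratic_growth \<Longrightarrow> (\<lambda>x. t * f x) \<in> Collect quadratic_growth \<Longrightarrow>
        L' (\<lambda>x. t * f x) = t * L' f"
    show thesis
      by (rule that[of L']) (simp_all add: L' quadratic_growth_add quadratic_growth_mult_left)
  qed
  have L_neg: "L (\<lambda>w. - f w) = - L f" if "quadratic_growth f" for f
    using L_scale[OF that, of "- 1"] by simp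
  have qneg: "quadratic_growth (\<lambda>w. - f w)" if "quadratic_growth f" for f :: "'a \<times> 'a \<times> 'a \<Rightarrow> real"
    using quadratic_growth_mult_left[OF that, of "- 1"] by simp
  have L_eq: "L f = r" if "quadratic_growth f" "(f, r) \<in> E0" "((\<lambda>w. - f w), - r) \<in> E0" for f r
    using L_le[OF that(1,2)] L_le[OF qneg[OF that(1)] that(3)] L_neg[OF that(1)] by simp
  have ok_zero: "ok (\<lambda>_. 0)" by (rule ok_const)
  have ok_neg: "ok (\<lambda>x. - u x)" if "ok u" for u
    using ok_mult[OF that, of "- 1"] by simp
  interpret \<mu>: prob_space \<mu> using P2(1) by (rule P2_prob_space)
  have marg1: "L (\<lambda>w. u (fst w)) = (\<integral>x. u x \<partial>\<mu>)" if "ok u" for u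
  proof (rule L_eq)
    show "quadratic_growth (\<lambda>w :: 'a \<times> 'a \<times> 'a. u (fst w))"
      using that quadratic_growth_triple[of u fst, OF _ norm_components_le(1)] by (simp add: ok_def)
    show "((\<lambda>w. u (fst w)), \<integral>x. u x \<partial>\<mu>) \<in> E0"
      by (rule E0_I[OF that ok_zero, of 0 _ _ "\<lambda>_. 0" "\<lambda>_. 0"]) auto
    show "((\<lambda>w. - u (fst w)), - (\<integral>x. u x \<partial>\<mu>)) \<in> E0"
      by (rule E0_I[OF ok_neg[OF that] ok_zero, of 0 _ _ "\<lambda>_. 0" "\<lambda>_. 0"]) auto
  qed
  have marg2: "L (\<lambda>w. u (fst (snd w))) = (\<integral>x. u x \<partial>\<nu>)" if "ok u" for u
  proof (rule L_eq)
    show "quadratic_growth (\<lambda>w :: 'a \<times> 'a \<times> 'a. u (fst (snd w)))"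
      using that quadratic_growth_triple[of u "\<lambda>w. fst (snd w)", OF _ norm_components_le(2)] by (simp add: ok_def)
    show "((\<lambda>w. u (fst (snd w))), \<integral>x. u x \<partial>\<nu>) \<in> E0"
      by (rule E0_I[OF ok_zero that, of 0 _ _ "\<lambda>_. 0" "\<lambda>_. 0"]) auto
    show "((\<lambda>w. - u (fst (snd w))), - (\<integral>x. u x \<partial>\<nu>)) \<in> E0"
      by (rule E0_I[OF ok_zero ok_neg[OF that], of 0 _ _ "\<lambda>_. 0" "\<lambda>_. 0"]) auto
  qed
  show ?thesis
  proof (rule that[of L])
    show "positive_functional L"
    proof
      fix f g :: "'a \<times> 'a \<times> 'a \<Rightarrow> real"
      assume f: "quadratic_growth f" and g: "quadratic_growth g" and fg: "\<And>w. f w \<le> g w"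
      \<comment> \<open>A nonpositive function is dominated by the zero data, at price 0: positivity
        is built into \<open>E0\<close> through the inequality in its definition.\<close>
      have "L (\<lambda>w. f w + - g w) \<le> 0"
        by (intro L_le quadratic_growth_add f qneg g E0_I[OF ok_zero ok_zero, of 0 _ _ "\<lambda>_. 0" "\<lambda>_. 0"])
          (auto simp: fg)
      then show "L f \<le> L g"
        using L_add[OF f qneg[OF g]] L_neg[OF g] by simp
    next
      show "L (\<lambda>_. 1) = 1"
        using marg1[OF ok_const[of 1]] by (simp add: \<mu>.prob_space)
    qed (fact L_add L_scale)+
  next
    fix p :: "'a \<Rightarrow> 'a" assume qg: "quadratic_growth (\<lambda>(x, y :: 'a, z). (z - x) \<bullet> p x)"
    show "L (\<lambda>(x, y, z). (z - x) \<bullet> p x) = 0"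
    proof (rule L_eq[OF qg])
      show "((\<lambda>(x, y, z). (z - x) \<bullet> p x), 0) \<in> E0"
        by (rule E0_I[OF ok_zero ok_zero, of 0 _ _ p "\<lambda>_. 0"]) (auto simp: inner_commute)
      show "((\<lambda>w. - (case w of (x, y, z) \<Rightarrow> (z - x) \<bullet> p x)), - 0) \<in> E0"
        by (rule E0_I[OF ok_zero ok_zero, of 0 _ _ "\<lambda>x. - p x" "\<lambda>_. 0"]) (auto simp: inner_commute)
    qed
  next
    fix p :: "'a \<Rightarrow> 'a" assume qg: "quadratic_growth (\<lambda>(x :: 'a, y, z). (z - y) \<bullet> p y)"
    show "L (\<lambda>(x, y, z). (z - y) \<bullet> p y) = 0"
    proof (rule L_eq[OF qg])
      show "((\<lambda>(x, y, z). (z - y) \<bullet> p y), 0) \<in> E0"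
        by (rule E0_I[OF ok_zero ok_zero, of 0 _ _ "\<lambda>_. 0" p]) (auto simp: inner_commute)
      show "((\<lambda>w. - (case w of (x, y, z) \<Rightarrow> (z - y) \<bullet> p y)), - 0) \<in> E0"
        by (rule E0_I[OF ok_zero ok_zero, of 0 _ _ "\<lambda>_. 0" "\<lambda>x. - p x"]) (auto simp: inner_commute)
    qed
  next
    show "L (\<lambda>(x, y, z). cost x y z) \<le> I"
    proof (rule L_le)
      show "quadratic_growth (\<lambda>(x :: 'a, y, z). cost x y z)"
      proof (rule quadratic_growthI)
        show "\<bar>case w of (x :: 'a, y, z) \<Rightarrow> cost x y z\<bar> \<le> 2 * (1 + (norm w)\<^sup>2)" for w
          using cost_le[of "fst w" "fst (snd w)" "snd (snd w)"] cost_nonneg[of "fst w" "fst (snd w)" "snd (snd w)"]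
          by (simp add: case_prod_unfold)
      qed
      show "((\<lambda>(x, y, z). cost x y z), I) \<in> E0"
        by (rule E0_I[OF ok_zero ok_zero, of 1 _ _ "\<lambda>_. 0" "\<lambda>_. 0"]) auto
    qed
  qed (auto simp: marg1 marg2 ok_def)
qed

text \<open>Each constraint is checked at a growth rate the measure can see: marginals on bounded
  bumps and martingale tests at linear growth, both with equality. The second moment and
  \<open>cost\<close> are quadratic, where integrability and an upper bound suffice.\<close>

lemma exists_coupling:
  fixes \<mu> \<nu> :: "'a::euclidean_space measure"
  assumes P2: "P2 \<mu>" "P2 \<nu>" and gain: "\<And>w. adm w \<Longrightarrow> gain \<mu> \<nu> w \<le> I"
  obtains \<pi> where "\<pi> \<in> Sigma_mart \<mu> \<nu>" "total_cost \<pi> \<le> I"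
proof -
  obtain L :: "('a \<times> 'a \<times> 'a \<Rightarrow> real) \<Rightarrow> real" where "positive_functional L"
    and L1: "\<And>u. u \<in> borel_measurable borel \<Longrightarrow> quadratic_growth u \<Longrightarrow> L (\<lambda>w. u (fst w)) = (\<integral>x. u x \<partial>\<mu>)"
    and L2: "\<And>u. u \<in> borel_measurable borel \<Longrightarrow> quadratic_growth u \<Longrightarrow> L (\<lambda>w. u (fst (snd w))) = (\<integral>x. u x \<partial>\<nu>)"
    and Lx: "\<And>p. quadratic_growth (\<lambda>(x, y :: 'a, z). (z - x) \<bullet> p x) \<Longrightarrow> L (\<lambda>(x, y, z). (z - x) \<bullet> p x) = 0"
    and Ly: "\<And>p. quadratic_growth (\<lambda>(x :: 'a, y, z). (z - y) \<bullet> p y) \<Longrightarrow> L (\<lambda>(x, y, z). (z - y) \<bullet> p y) = 0"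
    and Lc: "L (\<lambda>(x, y, z). cost x y z) \<le> I"
    using exists_positive_functional[OF P2 gain] by blast
  interpret L: positive_functional L by fact
  obtain \<pi> where \<pi>: "prob_space \<pi>" "sets \<pi> = sets borel"
    and rep: "\<And>f B. continuous_on UNIV f \<Longrightarrow> (\<And>x. \<bar>f x\<bar> \<le> B) \<Longrightarrow> (\<integral>x. f x \<partial>\<pi>) = L f"
    using L.representation by blast
  interpret prob_space \<pi> by fact
  have meas: "borel_measurable \<pi> = (borel_measurable borel :: ('a \<times> 'a \<times> 'a \<Rightarrow> 'a) set)"
    using \<pi>(2) by (intro measurable_cong_sets) auto
  have "P2 \<pi>"
    unfolding P2_def using \<pi>
    by (auto intro!: L.representation_integrable_nonneg(1)[OF \<pi> rep] continuous_intros quadratic_growth_norm_square)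
  have cost_qg: "quadratic_growth (\<lambda>(x :: 'a, y, z). cost x y z)"
  proof (rule quadratic_growthI)
    show "\<bar>case w of (x :: 'a, y, z) \<Rightarrow> cost x y z\<bar> \<le> 2 * (1 + (norm w)\<^sup>2)" for w
      using cost_le[of "fst w" "fst (snd w)" "snd (snd w)"] cost_nonneg[of "fst w" "fst (snd w)" "snd (snd w)"]
      by (simp add: case_prod_unfold)
  qed
  have "total_cost \<pi> \<le> L (\<lambda>(x, y, z). cost x y z)"
    unfolding total_cost_def
    by (rule L.representation_integrable_nonneg(2)[OF \<pi> rep continuous_on_cost cost_qg])
      (auto simp: cost_nonneg split: prod.split)
  then have cost: "total_cost \<pi> \<le> I"
    using Lc by simp
  have marginal: "distr \<pi> borel X = \<rho>"
    if X: "continuous_on UNIV X" and \<rho>: "P2 \<rho>"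
      and LX: "\<And>u. u \<in> borel_measurable borel \<Longrightarrow> quadratic_growth u \<Longrightarrow> L (\<lambda>w. u (X w)) = (\<integral>x. u x \<partial>\<rho>)"
    for X :: "'a \<times> 'a \<times> 'a \<Rightarrow> 'a" and \<rho>
  proof (rule measure_eqI_box_bump)
    have X_meas: "X \<in> borel_measurable \<pi>"
      unfolding meas using X by (rule borel_measurable_continuous_onI)
    show "finite_measure (distr \<pi> borel X)"
      using prob_space_distr[OF X_meas] by (rule prob_space.finite_measure)
    show "finite_measure \<rho>"
      using P2_prob_space[OF \<rho>] by (rule prob_space.finite_measure)
    show "sets (distr \<pi> borel X) = sets borel" "sets \<rho> = sets borel"
      using \<rho> by (simp_all add: P2_def)
    fix n and a b :: 'a
    have bound: "\<bar>box_bump n a b x\<bar> \<le> 1" for x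
      using box_bump_bounds[of n a b x] by simp
    have "(\<integral>x. box_bump n a b x \<partial>distr \<pi> borel X) = (\<integral>w. box_bump n a b (X w) \<partial>\<pi>)"
      by (rule integral_distr[OF X_meas box_bump_measurable])
    also have "\<dots> = L (\<lambda>w. box_bump n a b (X w))"
      using bound
      by (intro rep[of _ 1] continuous_on_compose2[OF flat_algebra_continuous[OF box_bump_flat_algebra] X]) auto
    also have "\<dots> = (\<integral>x. box_bump n a b x \<partial>\<rho>)"
      by (intro LX box_bump_measurable quadratic_growth_bounded[OF bound])
    finally show "(\<integral>x. box_bump n a b x \<partial>distr \<pi> borel X) = (\<integral>x. box_bump n a b x \<partial>\<rho>)" .
  qed
  have m1: "distr \<pi> borel fst = \<mu>"
    by (intro marginal P2 L1 continuous_intros)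
  have "distr \<pi> borel (\<lambda>w. fst (snd w)) = \<nu>"
    by (intro marginal P2 L2 continuous_intros)
  then have m2: "distr \<pi> borel (\<lambda>(x, y, z). y) = \<nu>"
    by (simp add: case_prod_unfold)
  \<comment> \<open>\<open>\<Phi>\<close> is bounded, so the integrand grows at most linearly and
    its square quadratically, as \<open>L.representation_subquadratic\<close> requires.\<close>
  have test: "(\<integral>w. (snd (snd w) - X w) \<bullet> \<Phi> (X w) \<partial>\<pi>) = L (\<lambda>w. (snd (snd w) - X w) \<bullet> \<Phi> (X w))
      \<and> quadratic_growth (\<lambda>w. (snd (snd w) - X w) \<bullet> \<Phi> (X w))"
    if \<Phi>: "smooth \<Phi>" "compact_support \<Phi>" and X: "continuous_on UNIV X" "\<And>w. norm (X w) \<le> norm w"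
    for \<Phi> :: "'a \<Rightarrow> 'a" and X :: "'a \<times> 'a \<times> 'a \<Rightarrow> 'a"
  proof -
    obtain B where B: "0 \<le> B" "\<And>x. norm (\<Phi> x) \<le> B"
      using smooth_compact_support_bounded[OF \<Phi>] by blast
    have \<Phi>_cont: "continuous_on UNIV \<Phi>"
      using \<Phi>(1) unfolding smooth_def by blast
    have le: "\<bar>(snd (snd w) - X w) \<bullet> \<Phi> (X w)\<bar> \<le> (2 * B) * norm w" for w
    proof -
      have "\<bar>(snd (snd w) - X w) \<bullet> \<Phi> (X w)\<bar> \<le> norm (snd (snd w) - X w) * norm (\<Phi> (X w))"
        by (rule Cauchy_Schwarz_ineq2)
      also have "\<dots> \<le> (2 * norm w) * B"
        using norm_triangle_ineq4[of "snd (snd w)" "X w"] norm_components_le(3)[of w] X(2)[of w] B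
        by (intro mult_mono) auto
      finally show ?thesis by (simp only: mult_ac)
    qed
    have sq: "quadratic_growth (\<lambda>w. ((snd (snd w) - X w) \<bullet> \<Phi> (X w))\<^sup>2)"
    proof (rule quadratic_growthI)
      fix w
      have "((snd (snd w) - X w) \<bullet> \<Phi> (X w))\<^sup>2 \<le> ((2 * B) * norm w)\<^sup>2"
        using power_mono[OF le[of w] abs_ge_zero, of 2] by simp
      also have "\<dots> \<le> (2 * B)\<^sup>2 * (1 + (norm w)\<^sup>2)"
        by (simp add: power_mult_distrib algebra_simps)
      finally show "\<bar>((snd (snd w) - X w) \<bullet> \<Phi> (X w))\<^sup>2\<bar> \<le> (2 * B)\<^sup>2 * (1 + (norm w)\<^sup>2)"
        by simp
    qed
    have qg: "quadratic_growth (\<lambda>w. (snd (snd w) - X w) \<bullet> \<Phi> (X w))"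
    proof (rule quadratic_growthI)
      fix w
      show "\<bar>(snd (snd w) - X w) \<bullet> \<Phi> (X w)\<bar> \<le> (2 * B) * (1 + (norm w)\<^sup>2)"
        using le[of w] mult_left_mono[OF norm_le_one_plus_square[of w], of "2 * B"] B(1) by linarith
    qed
    have cont: "continuous_on UNIV (\<lambda>w. (snd (snd w) - X w) \<bullet> \<Phi> (X w))"
      by (intro continuous_intros X continuous_on_compose2[OF \<Phi>_cont X(1)]) auto
    have "(\<integral>w. (snd (snd w) - X w) \<bullet> \<Phi> (X w) \<partial>\<pi>) = L (\<lambda>w. (snd (snd w) - X w) \<bullet> \<Phi> (X w))"
      by (rule L.representation_subquadratic[OF \<pi> _ cont sq]) (rule rep)
    with qg show ?thesis by blast
  qed
  have "(\<integral>(x,y,z). (z - x) \<bullet> \<Phi> x \<partial>\<pi>) = 0" if "smooth \<Phi>" "compact_support \<Phi>" for \<Phi> :: "'a \<Rightarrow> 'a"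
    using test[OF that continuous_on_fst[OF continuous_on_id] norm_components_le(1)] Lx[of \<Phi>]
    by (simp add: case_prod_unfold)
  moreover have "(\<integral>(x,y,z). (z - y) \<bullet> \<Phi> y \<partial>\<pi>) = 0" if "smooth \<Phi>" "compact_support \<Phi>" for \<Phi> :: "'a \<Rightarrow> 'a"
    using test[OF that continuous_on_fst[OF continuous_on_snd[OF continuous_on_id]] norm_components_le(2)] Ly[of \<Phi>]
    by (simp add: case_prod_unfold)
  ultimately have "\<pi> \<in> Sigma_mart \<mu> \<nu>"
    unfolding Sigma_mart_def using \<open>P2 \<pi>\<close> m1 m2 by blast
  with cost show ?thesis using that by blast
qed

theorem theorem1p1:
  fixes \<mu> \<nu> :: "'a::euclidean_space measure"
  assumes "P2 \<mu>" and "P2 \<nu>" and "bary \<mu> = bary \<nu>"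
  shows "Ival \<mu> \<nu> = Jval \<mu> \<nu> \<and>
         (\<exists>u. adm u \<and> ereal (gain \<mu> \<nu> u) = Ival \<mu> \<nu>) \<and>
         (\<exists>\<pi>\<in>Sigma_mart \<mu> \<nu>. ereal (total_cost \<pi>) = Jval \<mu> \<nu>) \<and>
         (\<forall>u \<pi>. adm u \<and> \<pi> \<in> Sigma_mart \<mu> \<nu> \<longrightarrow>
          ((ereal (gain \<mu> \<nu> u) = Ival \<mu> \<nu> \<and> ereal (total_cost \<pi>) = Jval \<mu> \<nu>) \<longleftrightarrow>
           (AE p in \<pi>. case p of (x, y, z) \<Rightarrow>
              (u y + grad u y \<bullet> (z - y)) - (u x + grad u x \<bullet> (z - x)) = cost x y z)))"
proof -
  obtain u0 where u0: "adm u0" "\<And>w. adm w \<Longrightarrow> gain \<mu> \<nu> w \<le> gain \<mu> \<nu> u0"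
    using exists_gain_maximiser[OF assms] by blast
  obtain \<pi>0 where \<pi>0: "\<pi>0 \<in> Sigma_mart \<mu> \<nu>" "total_cost \<pi>0 \<le> gain \<mu> \<nu> u0"
    using exists_coupling[OF assms(1,2) u0(2)] by blast
  \<comment> \<open>The duality gap of any admissible pair is the integral of a pointwise
    nonnegative function; weak duality and complementary slackness are read off from it.\<close>
  have slack: "total_cost \<pi> - gain \<mu> \<nu> u = (\<integral>(x, y, z). cost x y z - contact_gap u x y z \<partial>\<pi>)"
      "integrable \<pi> (\<lambda>(x, y, z). cost x y z - contact_gap u x y z)"
    if "adm u" "\<pi> \<in> Sigma_mart \<mu> \<nu>" for u \<pi>
  proof -
    note ints = Sigma_mart_integrals[OF that assms(1,2)]
    have eq: "(\<lambda>(x, y, z). cost x y z - contact_gap u x y z)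
        = (\<lambda>w. (case w of (x, y, z) \<Rightarrow> cost x y z) - (case w of (x, y, z) \<Rightarrow> contact_gap u x y z))"
      by (simp add: case_prod_unfold)
    show "total_cost \<pi> - gain \<mu> \<nu> u = (\<integral>(x, y, z). cost x y z - contact_gap u x y z \<partial>\<pi>)"
      unfolding eq Bochner_Integration.integral_diff[OF ints(3,1)] ints(2) total_cost_def ..
    show "integrable \<pi> (\<lambda>(x, y, z). cost x y z - contact_gap u x y z)"
      unfolding eq using ints(3,1) by (rule Bochner_Integration.integrable_diff)
  qed
  have weak: "gain \<mu> \<nu> u \<le> total_cost \<pi>" if "adm u" "\<pi> \<in> Sigma_mart \<mu> \<nu>" for u \<pi>
  proof -
    have "0 \<le> (\<integral>(x, y, z). cost x y z - contact_gap u x y z \<partial>\<pi>)"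
      using contact_gap_le_cost[OF that(1)] by (intro integral_nonneg_AE AE_I2) (auto split: prod.split)
    then show ?thesis using slack(1)[OF that] by simp
  qed
  have I: "Ival \<mu> \<nu> = ereal (gain \<mu> \<nu> u0)"
    unfolding Ival_def using u0 by (intro antisym SUP_least SUP_upper) auto
  have c0: "total_cost \<pi>0 = gain \<mu> \<nu> u0"
    using weak[OF u0(1) \<pi>0(1)] \<pi>0(2) by simp
  have J: "Jval \<mu> \<nu> = ereal (gain \<mu> \<nu> u0)"
  proof (rule antisym)
    show "Jval \<mu> \<nu> \<le> ereal (gain \<mu> \<nu> u0)"
      unfolding Jval_def c0[symmetric] using \<pi>0(1) by (rule INF_lower)
    show "ereal (gain \<mu> \<nu> u0) \<le> Jval \<mu> \<nu>"
      unfolding Jval_def using weak[OF u0(1)] by (intro INF_greatest) auto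
  qed
  have "(ereal (gain \<mu> \<nu> u) = Ival \<mu> \<nu> \<and> ereal (total_cost \<pi>) = Jval \<mu> \<nu>) \<longleftrightarrow>
      (AE (x, y, z) in \<pi>. contact_gap u x y z = cost x y z)"
    if "adm u" "\<pi> \<in> Sigma_mart \<mu> \<nu>" for u \<pi>
  proof -
    \<comment> \<open>The common optimal value separates all gains from all costs, so equality of
      the two numbers forces both to be optimal.\<close>
    have "(ereal (gain \<mu> \<nu> u) = Ival \<mu> \<nu> \<and> ereal (total_cost \<pi>) = Jval \<mu> \<nu>) \<longleftrightarrow> gain \<mu> \<nu> u = total_cost \<pi>"
      using I J u0(2)[OF that(1)] weak[OF u0(1) that(2)] by auto
    also have "\<dots> \<longleftrightarrow> (\<integral>(x, y, z). cost x y z - contact_gap u x y z \<partial>\<pi>) = 0"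
      using slack(1)[OF that] by auto
    also have "\<dots> \<longleftrightarrow> (AE w in \<pi>. (case w of (x, y, z) \<Rightarrow> cost x y z - contact_gap u x y z) = 0)"
      using contact_gap_le_cost[OF that(1)]
      by (intro integral_nonneg_eq_0_iff_AE slack(2)[OF that] AE_I2) (auto split: prod.split)
    also have "\<dots> \<longleftrightarrow> (AE (x, y, z) in \<pi>. contact_gap u x y z = cost x y z)"
      by (intro arg_cong[of _ _ "\<lambda>P. AE w in \<pi>. P w"]) (auto simp: fun_eq_iff)
    finally show ?thesis .
  qed
  then show ?thesis
    using I J u0(1) \<pi>0(1) c0 by auto
qed

end
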